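(* Let $\beta=1$, $\alpha\in(0,2]$, $\nu>0$, let $d\ge1$ be an integer with $d<\min\{2,\beta^{-1}\}\alpha=\alpha$, and let $u_0:\mathbb{R}^d\to\mathbb{R}$ be measurable and bounded, with $\inf_{x\in\mathbb{R}^d}u_0(x)>0$. Suppose that (a) there exist a non-negative function $J$ on $\mathbb{R}^d$ and finite positive constants $Lip_\sigma,K$ with $\sigma(0,h)=0$, $|\sigma(x,h)-\sigma(y,h)|\le J(h)Lip_\sigma|x-y|$ for all $x,y\in\mathbb{R}$, $h\in\mathbb{R}^d$, and $\int_{\mathbb{R}^d}J(h)^2\mu(dh)\le K$; (b) there exist a positive function $\overline J$ on $\mathbb{R}^d$ and constants $L>0$, $\kappa>0$ with $|\sigma(x,h)|\ge L\overline J(h)|x|$ for all $x\in\mathbb{R}$, $h\in\mathbb{R}^d$, and $\int_{\mathbb{R}^d}\overline J(h)^2\mu(dh)\ge\kappa$. Let $u$ be the random field solution of $$\frac{\partial u}{\partial t}+\nu(-\Delta)^{\alpha/2}u=\int_{\mathbb{R}^d}\sigma(u(t,x),h)\,\dot{\tilde N}(t,x,h),\qquad u(0,\cdot)=u_0.$$ Then $$\overline\gamma(2)\ge\Upsilon^{-1}\Big(\frac1{\kappa L^2}\Big)>0,$$ where $\overline\gamma(2):=\limsup_{t\to\infty}\frac1t\ln\mathbb{E}|u(t,x)|^2$ (the inequality holding at every $x\in\mathbb{R}^d$), $\Upsilon(\lambda):=\frac1{2\pi}\int_{\mathbb{R}^d}\frac{d\xi}{\lambda+2\nu|\xi|^\alpha}$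 for $\lambda\in(0,\infty)$, and $\Upsilon^{-1}(t):=\sup\{\lambda>0:\Upsilon(\lambda)>t\}$.
   Context: Noise: $\mu$ is a Lévy measure on $\mathbb{R}^d$, i.e. $\int_{\mathbb{R}^d}(1\wedge|h|^2)\mu(dh)<\infty$. $N$ is a Poisson random measure on $\mathbb{R}_+\times\mathbb{R}^d\times\mathbb{R}^d$ with intensity $dt\,dx\,\mu(dh)$, and $\tilde N(ds\,dx\,dh)=N(ds\,dx\,dh)-ds\,dx\,\mu(dh)$. Predictability is with respect to the filtration generated by $N$. For predictable $X$ with $\int_0^T\int\int \mathbb{E}|X(s,x,h)|^2\,ds\,dx\,\mu(dh)<\infty$, the integral $\int_0^T\int\int X\,d\tilde N$ is defined and satisfies $\mathbb{E}|\int X\,d\tilde N|^2=\int_0^T\int\int\mathbb{E}X^2\,ds\,dx\,\mu(dh)$. The function $\sigma:\mathbb{R}\times\mathbb{R}^d\to\mathbb{R}$ is jointly measurable. Kernel: $G(t,x)=p(t,x)$ is the transition density of the isotropic $\alpha$-stable process on $\mathbb{R}^d$ with generator $-\nu(-\Delta)^{\alpha/2}$, i.e. its Fourier transform in $x$ is $e^{-t\nu|\xi|^\alpha}$ (characteristic exponent $\psi(\xi)=\nu|\xi|^\alpha$). The equation is interpreted in the mild sense. A (predictable) random field $\{u(t,x)\}_{t>0,x\in\mathbb{R}^d}$ is a mild solution with initial condition $u_0$ if, for all $t,x$, a.s., $$u(t,x)=\int_{\mathbb{R}^d}G(t,x-y)u_0(y)\,dy+\int_0^t\int_{\mathbb{R}^d}\int_{\mathbb{R}^d}G(t-s,x-y)\sigma(u(s,y),h)\,\tilde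 N(ds\,dy\,dh).$$ It is a random field solution if moreover $\sup_{0\le t\le T}\sup_{x\in\mathbb{R}^d}\mathbb{E}|u(t,x)|^2<\infty$ for all $T>0$. *)

theory Defs
  imports "HOL-Probability.Probability"
begin

section \<open>The Poisson noise\<close>

definition levy_measure :: "'a::euclidean_space measure \<Rightarrow> bool" where
  "levy_measure \<mu> \<longleftrightarrow>
     sets \<mu> = sets borel \<and> (\<integral>\<^sup>+h. ennreal (min 1 ((norm h)\<^sup>2)) \<partial>\<mu>) < \<infinity>"

(* Explicit Poisson weights instead of poisson_pmf, since the rate may be 0. *)
definition poisson_random_measure ::
    "'w measure \<Rightarrow> 'e measure \<Rightarrow> ('w \<Rightarrow> 'e measure) \<Rightarrow> bool" where
  "poisson_random_measure M \<Lambda> N \<longleftrightarrow>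
     (\<forall>\<omega>\<in>space M. sets (N \<omega>) = sets \<Lambda>) \<and>
     (\<forall>B\<in>sets \<Lambda>. (\<lambda>\<omega>. emeasure (N \<omega>) B) \<in> borel_measurable M) \<and>
     (\<forall>B\<in>sets \<Lambda>. emeasure \<Lambda> B < \<infinity> \<longrightarrow>
        (\<forall>k::nat. measure M {\<omega>\<in>space M. emeasure (N \<omega>) B = of_nat k} =
           exp (- measure \<Lambda> B) * measure \<Lambda> B ^ k / fact k)) \<and>
     (\<forall>(I::nat set) B. finite I \<and> B ` I \<subseteq> sets \<Lambda> \<and> disjoint_family_on B I \<longrightarrow>
        prob_space.indep_vars M (\<lambda>_. borel) (\<lambda>i \<omega>. emeasure (N \<omega>) (B i)) I)"

definition noise_intensity ::
    "'a::euclidean_space measure \<Rightarrow> (real \<times> 'a \<times> 'a) measure" where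
  "noise_intensity \<mu> = restrict_space lborel {0..} \<Otimes>\<^sub>M (lborel \<Otimes>\<^sub>M \<mu>)"

definition noise_filtration ::
    "'w measure \<Rightarrow> 'a::euclidean_space measure \<Rightarrow> ('w \<Rightarrow> (real \<times> 'a \<times> 'a) measure)
       \<Rightarrow> real \<Rightarrow> 'w measure" where
  "noise_filtration M \<mu> N t =
     sigma (space M)
       {(\<lambda>\<omega>. emeasure (N \<omega>) B) -` U \<inter> space M | B U.
          B \<in> sets (noise_intensity \<mu>) \<and> B \<subseteq> {0..t} \<times> UNIV \<and> U \<in> sets borel}"

section \<open>Predictable fields and the compensated Poisson integral\<close>

definition predictable_sigma :: "'w measure \<Rightarrow> (real \<Rightarrow> 'w measure) \<Rightarrow> (real \<times> 'w) measure" where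
  "predictable_sigma M F =
     sigma ({0<..} \<times> space M)
       {{a<..b} \<times> A | a b A. 0 \<le> a \<and> a < b \<and> A \<in> sets (F a)}"

(* The field is indexed by (t, z) with z in 'b: 'b is R^d for a solution and R^d x R^d for an
   integrand. Only times t > 0 matter. *)
definition predictable_field ::
    "'w measure \<Rightarrow> (real \<Rightarrow> 'w measure) \<Rightarrow> (real \<Rightarrow> 'b::topological_space \<Rightarrow> 'w \<Rightarrow> real) \<Rightarrow> bool" where
  "predictable_field M F X \<longleftrightarrow>
     (\<lambda>((t, \<omega>), z). X t z \<omega>) \<in> borel_measurable (predictable_sigma M F \<Otimes>\<^sub>M borel)"

definition integrand_sqnorm ::
    "'w measure \<Rightarrow> 'a::euclidean_space measure \<Rightarrow> (real \<Rightarrow> 'a \<times> 'a \<Rightarrow> 'w \<Rightarrow> real) \<Rightarrow> ennreal" where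
  "integrand_sqnorm M \<mu> X =
     (\<integral>\<^sup>+s\<in>{0<..}. (\<integral>\<^sup>+y. (\<integral>\<^sup>+h. (\<integral>\<^sup>+\<omega>. ennreal ((X s (y, h) \<omega>)\<^sup>2) \<partial>M) \<partial>\<mu>) \<partial>lborel) \<partial>lborel)"

definition compensated ::
    "'e measure \<Rightarrow> ('w \<Rightarrow> 'e measure) \<Rightarrow> 'e set \<Rightarrow> 'w \<Rightarrow> real" where
  "compensated \<Lambda> N B \<omega> = measure (N \<omega>) B - measure \<Lambda> B"

(* X is a finite sum of elementary processes Y(\<omega>) 1_(a,b](s) 1_A(y) 1_H(h), with Y bounded and
   measurable at time a, and I is its integral: the sum of the Y times the compensated measure of
   the box (a,b] x A x H. *)
definition simple_integral_pair ::
    "'w measure \<Rightarrow> 'a::euclidean_space measure \<Rightarrow> ('w \<Rightarrow> (real \<times> 'a \<times> 'a) measure)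
       \<Rightarrow> (real \<Rightarrow> 'a \<times> 'a \<Rightarrow> 'w \<Rightarrow> real) \<Rightarrow> ('w \<Rightarrow> real) \<Rightarrow> bool" where
  "simple_integral_pair M \<mu> N X I \<longleftrightarrow>
     (\<exists>(n::nat) Y a b A H.
        (\<forall>i<n. 0 \<le> a i \<and> a i < b i \<and>
           Y i \<in> borel_measurable (noise_filtration M \<mu> N (a i)) \<and> bounded (Y i ` space M) \<and>
           A i \<in> sets borel \<and> emeasure lborel (A i) < \<infinity> \<and>
           H i \<in> sets borel \<and> emeasure \<mu> (H i) < \<infinity>) \<and>
        X = (\<lambda>s z \<omega>. \<Sum>i<n. Y i \<omega> * indicator ({a i<..b i} \<times> A i \<times> H i) (s, z)) \<and>
        I = (\<lambda>\<omega>. \<Sum>i<n. Y i \<omega> *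
               compensated (noise_intensity \<mu>) N ({a i<..b i} \<times> A i \<times> H i) \<omega>))"

(* X is a predictable square-integrable integrand on (0,\<infinity>) x R^d x R^d and I is (a version of)
   its integral against the compensated measure: the L2 extension of the integral of simple
   processes. The integral up to a time T is the integral of X truncated to (0,T). *)
definition has_compensated_integral ::
    "'w measure \<Rightarrow> 'a::euclidean_space measure \<Rightarrow> ('w \<Rightarrow> (real \<times> 'a \<times> 'a) measure)
       \<Rightarrow> (real \<Rightarrow> 'a \<times> 'a \<Rightarrow> 'w \<Rightarrow> real) \<Rightarrow> ('w \<Rightarrow> real) \<Rightarrow> bool" where
  "has_compensated_integral M \<mu> N X I \<longleftrightarrow>
     predictable_field M (noise_filtration M \<mu> N) X \<and>
     integrand_sqnorm M \<mu> X < \<infinity> \<and>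
     I \<in> borel_measurable M \<and>
     (\<exists>S J. (\<forall>n::nat. simple_integral_pair M \<mu> N (S n) (J n)) \<and>
        (\<lambda>n. integrand_sqnorm M \<mu> (\<lambda>s z \<omega>. S n s z \<omega> - X s z \<omega>)) \<longlonglongrightarrow> 0 \<and>
        (\<lambda>n. \<integral>\<^sup>+\<omega>. ennreal ((J n \<omega> - I \<omega>)\<^sup>2) \<partial>M) \<longlonglongrightarrow> 0)"

section \<open>The stable kernel\<close>

(* G(t,.) is only determined up to null sets by its Fourier transform; any jointly measurable
   version is admitted, in particular the continuous one. *)
definition stable_transition_density ::
    "real \<Rightarrow> real \<Rightarrow> (real \<Rightarrow> 'a::euclidean_space \<Rightarrow> real) \<Rightarrow> bool" where
  "stable_transition_density \<nu> \<alpha> G \<longleftrightarrow>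
     (\<lambda>(t, x). G t x) \<in> borel_measurable (restrict_space borel {0<..} \<Otimes>\<^sub>M borel) \<and>
     (\<forall>t>0. (\<forall>x. 0 \<le> G t x) \<and> integrable lborel (G t) \<and>
        (\<forall>\<xi>. (LINT x|lborel. complex_of_real (G t x) * cis (\<xi> \<bullet> x)) =
           complex_of_real (exp (- t * \<nu> * norm \<xi> powr \<alpha>))))"

section \<open>Solutions and growth exponents\<close>

definition mild_solution ::
    "'w measure \<Rightarrow> 'a::euclidean_space measure \<Rightarrow> ('w \<Rightarrow> (real \<times> 'a \<times> 'a) measure)
       \<Rightarrow> (real \<Rightarrow> 'a \<Rightarrow> real) \<Rightarrow> (real \<Rightarrow> 'a \<Rightarrow> real) \<Rightarrow> ('a \<Rightarrow> real)
       \<Rightarrow> (real \<Rightarrow> 'a \<Rightarrow> 'w \<Rightarrow> real) \<Rightarrow> bool" where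
  "mild_solution M \<mu> N G \<sigma> u0 u \<longleftrightarrow>
     predictable_field M (noise_filtration M \<mu> N) u \<and>
     (\<forall>x. AE \<omega> in M. u 0 x \<omega> = u0 x) \<and>
     (\<forall>t>0. \<forall>x. \<exists>I.
        has_compensated_integral M \<mu> N
          (\<lambda>s (y, h) \<omega>. indicator {0<..<t} s * (G (t - s) (x - y) * \<sigma> (u s y \<omega>) h)) I \<and>
        (AE \<omega> in M. u t x \<omega> = (LINT y|lborel. G t (x - y) * u0 y) + I \<omega>))"

definition random_field_solution ::
    "'w measure \<Rightarrow> 'a::euclidean_space measure \<Rightarrow> ('w \<Rightarrow> (real \<times> 'a \<times> 'a) measure)
       \<Rightarrow> (real \<Rightarrow> 'a \<Rightarrow> real) \<Rightarrow> (real \<Rightarrow> 'a \<Rightarrow> real) \<Rightarrow> ('a \<Rightarrow> real)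
       \<Rightarrow> (real \<Rightarrow> 'a \<Rightarrow> 'w \<Rightarrow> real) \<Rightarrow> bool" where
  "random_field_solution M \<mu> N G \<sigma> u0 u \<longleftrightarrow>
     mild_solution M \<mu> N G \<sigma> u0 u \<and>
     (\<forall>T>0. (SUP t\<in>{0..T}. SUP x. \<integral>\<^sup>+\<omega>. ennreal (\<bar>u t x \<omega>\<bar>\<^sup>2) \<partial>M) < \<infinity>)"

definition upper_second_moment_exponent ::
    "'w measure \<Rightarrow> (real \<Rightarrow> 'a \<Rightarrow> 'w \<Rightarrow> real) \<Rightarrow> 'a \<Rightarrow> ereal" where
  "upper_second_moment_exponent M u x =
     Limsup at_top (\<lambda>t. ereal (1 / t * ln (LINT \<omega>|M. \<bar>u t x \<omega>\<bar>\<^sup>2)))"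

(* The itself argument fixes the space R^d over which the frequency variable ranges. *)
definition Upsilon :: "'a::euclidean_space itself \<Rightarrow> real \<Rightarrow> real \<Rightarrow> real \<Rightarrow> ennreal" where
  "Upsilon _ \<nu> \<alpha> l =
     ennreal (1 / (2 * pi)) *
       (\<integral>\<^sup>+(\<xi>::'a). ennreal (1 / (l + 2 * \<nu> * norm \<xi> powr \<alpha>)) \<partial>lborel)"

definition Upsilon_inv :: "'a::euclidean_space itself \<Rightarrow> real \<Rightarrow> real \<Rightarrow> real \<Rightarrow> ereal" where
  "Upsilon_inv T \<nu> \<alpha> r = Sup (ereal ` {l. 0 < l \<and> Upsilon T \<nu> \<alpha> l > ennreal r})"

end

theory Submission
  imports Defs
begin

text \<open>
  Since \<open>d < \<alpha> \<le> 2\<close>, necessarily \<open>d = 1\<close> and \<open>\<alpha> > 1\<close>. The isometry of the compensated integral and the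
  lower bound on \<open>\<sigma>\<close> give, for \<open>c = inf u\<^sub>0\<close> and \<open>b(t) = \<integral> G(t,y)\<^sup>2 dy\<close>, the renewal inequality
  \<open>E u(t,x)\<^sup>2 \<ge> c\<^sup>2 + \<kappa> L\<^sup>2 \<integral>\<^sub>0\<^sup>t b(t-s) inf\<^sub>y E u(s,y)\<^sup>2 ds\<close>. Its iterates \<open>h\<^sub>n\<close>, started from \<open>c\<^sup>2\<close>, do not
  depend on \<open>x\<close> and stay below \<open>E u(t,x)\<^sup>2\<close>. The Laplace transform of \<open>b\<close> at \<open>l\<close> is at least
  \<open>\<Upsilon>(l)\<close> by the Plancherel inequality, so if \<open>\<kappa> L\<^sup>2 \<Upsilon>(l) \<ge> 1\<close>, then the Laplace transform of \<open>h\<^sub>n\<close> at \<open>l\<close>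
  is at least \<open>(n+1) c\<^sup>2 / l\<close>. As this is unbounded in \<open>n\<close>, the second moment cannot have an exponential growth
  rate below \<open>l\<close> at any point.
\<close>

text \<open>The infimum over \<open>y\<close> of the second moments runs over uncountably many
  points, and its measurability in time is not at hand. The renewal inequality is therefore proved
  with an arbitrary measurable minorant \<open>r\<close> of the second moments in place of the
  infimum, and it is fed with explicit deterministic iterates only. Working with iterates also keeps
  the lower bounds in [0, infinity], where Laplace transforms may be infinite; finiteness enters
  only through the growth rate that is to be refuted. The shape of \<open>Upsilon\<close> comes from
  the kernel: squaring the Fourier transform exp(-t \<nu> |\<xi>|^\<alpha>) produces the factor 2
  \<nu>, integrating it against exp(-l t) produces the denominator, and 1/(2 pi) is the
  one-dimensional Plancherel constant. Strict positivity of \<open>Upsilon_inv\<close> expresses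
  that \<open>Upsilon\<close> is unbounded near zero, which is where \<alpha> > 1 acts. The isometry
  and the Plancherel theorem appear as the one-sided bounds that survive their approximations, by
  simple integrands and by Gaussian weights respectively.\<close>

section \<open>The energy of the stable kernel\<close>

text \<open>Scaling by \<open>n\<close> turns the weight into the standard normal density times
  sqrt(2 pi), whose characteristic function is known. The result is written as 2 pi times a normal
  density so that later only its unit mass has to be used.\<close>

lemma gaussian_fourier:
  assumes "0 < n"
  shows "(LINT \<xi>|lborel. complex_of_real (exp (- \<xi>\<^sup>2 / (2 * n\<^sup>2))) * cis (\<xi> * z)) =
    complex_of_real (2 * pi * normal_density 0 (1 / n) z)"
proof -
  have "(LINT \<xi>|lborel. complex_of_real (exp (- \<xi>\<^sup>2 / (2 * n\<^sup>2))) * cis (\<xi> * z)) =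
     n *\<^sub>R (LINT x|lborel. complex_of_real (exp (- (n * x)\<^sup>2 / (2 * n\<^sup>2))) * cis (n * x * z))"
    using assms by (subst lborel_integral_real_affine[where c = n and t = 0]) auto
  also have "(LINT x|lborel. complex_of_real (exp (- (n * x)\<^sup>2 / (2 * n\<^sup>2))) * cis (n * x * z)) =
     (LINT x|lborel. complex_of_real (sqrt (2 * pi)) * (std_normal_density x *\<^sub>R iexp (n * z * x)))"
    using assms
    by (intro Bochner_Integration.integral_cong)
       (auto simp: std_normal_density_def power_mult_distrib cis_conv_exp scaleR_conv_of_real mult_ac)
  also have "\<dots> = complex_of_real (sqrt (2 * pi)) * char std_normal_distribution (n * z)"
    by (subst integral_mult_right_zero) (simp add: char_def integral_density)
  also have "n *\<^sub>R \<dots> = complex_of_real (n * (sqrt (2 * pi) * exp (- (n * z)\<^sup>2 / 2)))"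
    by (simp add: char_std_normal_distribution scaleR_conv_of_real)
  also have "n * (sqrt (2 * pi) * exp (- (n * z)\<^sup>2 / 2)) = 2 * pi * normal_density 0 (1 / n) z"
  proof -
    have "sqrt (2 * pi * (1 / n)\<^sup>2) = sqrt (2 * pi) / n"
      using assms by (simp add: real_sqrt_mult real_sqrt_divide power_divide)
    then have "normal_density 0 (1 / n) z = n / sqrt (2 * pi) * exp (- (n * z)\<^sup>2 / 2)"
      using assms unfolding normal_density_def by (simp add: power_mult_distrib power_divide mult_ac)
    then have "2 * pi * normal_density 0 (1 / n) z =
        2 * pi / sqrt (2 * pi) * (n * exp (- (n * z)\<^sup>2 / 2))"
      by (simp only: times_divide_eq_left times_divide_eq_right mult_ac)
    also have "2 * pi / sqrt (2 * pi) = sqrt (2 * pi)" by (rule real_div_sqrt) simp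
    finally show ?thesis by (simp only: mult_ac)
  qed
  finally show ?thesis .
qed

section \<open>Plancherel's inequality for nonnegative integrable functions\<close>

lemma nn_integral_normal_density: "0 < s \<Longrightarrow> (\<integral>\<^sup>+x. ennreal (normal_density m s x) \<partial>lborel) = 1"
  by (subst nn_integral_eq_integral) auto

text \<open>The nonintegrable case is covered by the default value 0 of the Bochner
  integral.\<close>

lemma ennreal_integral_le_nn_integral:
  assumes "\<And>x. 0 \<le> f x" shows "ennreal (integral\<^sup>L M f) \<le> (\<integral>\<^sup>+x. ennreal (f x) \<partial>M)"
proof (cases "integrable M f")
  case True
  then show ?thesis using assms by (simp add: nn_integral_eq_integral)
qed (simp add: not_integrable_integral_eq)

text \<open>This is the contraction property of convolution with a probability density on L2, in the
  form of a Schur test: after splitting the product \<open>g x * g y\<close>, each half is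
  integrated first in the variable that it does not contain, where the kernel has mass one.\<close>

lemma nn_integral_normal_quadratic_form_le:
  fixes g :: "real \<Rightarrow> real"
  assumes [measurable]: "g \<in> borel_measurable borel" and "0 < s"
  shows "(\<integral>\<^sup>+x. \<integral>\<^sup>+y. ennreal (g x * g y * normal_density 0 s (x - y)) \<partial>lborel \<partial>lborel)
    \<le> (\<integral>\<^sup>+x. ennreal ((g x)\<^sup>2) \<partial>lborel)"
proof -
  \<comment> \<open>The normal density is symmetric in mean and argument, so the kernel may be
    written with mean \<open>x\<close> next to \<open>g x\<close> and with mean \<open>y\<close>
    next to \<open>g y\<close>.\<close>
  have amgm: "g x * g y * normal_density 0 s (x - y) \<le>
      (g x)\<^sup>2 / 2 * normal_density x s y + (g y)\<^sup>2 / 2 * normal_density y s x" for x y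
  proof -
    have "normal_density 0 s (x - y) = normal_density x s y"
      "normal_density y s x = normal_density x s y"
      by (simp_all add: normal_density_def power2_commute)
    moreover have "g x * g y \<le> (g x)\<^sup>2 / 2 + (g y)\<^sup>2 / 2"
      using sum_squares_bound[of "g x" "g y"] by simp
    ultimately show ?thesis
      using mult_right_mono[of "g x * g y" "(g x)\<^sup>2 / 2 + (g y)\<^sup>2 / 2" "normal_density x s y"]
      by (simp add: distrib_right)
  qed
  let ?h = "\<lambda>x y. ennreal ((g x)\<^sup>2 / 2) * ennreal (normal_density x s y)"
  have [measurable]: "(\<lambda>(x, y). normal_density x s y) \<in> borel_measurable (borel \<Otimes>\<^sub>M borel)"
    unfolding normal_density_def by measurable
  have h: "(\<integral>\<^sup>+x. \<integral>\<^sup>+y. ?h x y \<partial>lborel \<partial>lborel) = (\<integral>\<^sup>+x. ennreal ((g x)\<^sup>2 / 2) \<partial>lborel)"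
    by (simp add: nn_integral_cmult nn_integral_normal_density[OF \<open>0 < s\<close>])
  have "(\<integral>\<^sup>+x. \<integral>\<^sup>+y. ennreal (g x * g y * normal_density 0 s (x - y)) \<partial>lborel \<partial>lborel)
      \<le> (\<integral>\<^sup>+x. \<integral>\<^sup>+y. ?h x y + ?h y x \<partial>lborel \<partial>lborel)"
    by (intro nn_integral_mono)
      (use amgm in \<open>simp add: ennreal_leI flip: ennreal_mult' ennreal_plus\<close>)
  also have "\<dots> = (\<integral>\<^sup>+x. \<integral>\<^sup>+y. ?h x y \<partial>lborel \<partial>lborel) + (\<integral>\<^sup>+x. \<integral>\<^sup>+y. ?h y x \<partial>lborel \<partial>lborel)"
    by (simp add: nn_integral_add)
  also have "(\<integral>\<^sup>+x. \<integral>\<^sup>+y. ?h y x \<partial>lborel \<partial>lborel) = (\<integral>\<^sup>+x. \<integral>\<^sup>+y. ?h x y \<partial>lborel \<partial>lborel)"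
    by (subst lborel_pair.Fubini') simp_all
  also have "(\<integral>\<^sup>+x. \<integral>\<^sup>+y. ?h x y \<partial>lborel \<partial>lborel) + (\<integral>\<^sup>+x. \<integral>\<^sup>+y. ?h x y \<partial>lborel \<partial>lborel) =
      (\<integral>\<^sup>+x. ennreal ((g x)\<^sup>2) \<partial>lborel)"
    unfolding h by (subst nn_integral_add[symmetric]) (simp_all flip: ennreal_plus)
  finally show ?thesis .
qed

(* The Gaussian weight makes Fubini applicable. Its Fourier transform is a normal density, so the
   weighted integral is a quadratic form in g, which AM-GM bounds. *)
lemma fourier_gaussian_weight_le:
  fixes g :: "real \<Rightarrow> real"
  assumes int: "integrable lborel g" and nn: "\<And>x. 0 \<le> g x" and n: "0 < n"
  defines "\<phi> \<equiv> \<lambda>\<xi>. LINT x|lborel. complex_of_real (g x) * cis (\<xi> * x)"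
  shows "(\<integral>\<^sup>+\<xi>. ennreal (exp (- \<xi>\<^sup>2 / (2 * n\<^sup>2)) * (cmod (\<phi> \<xi>))\<^sup>2) \<partial>lborel)
    \<le> ennreal (2 * pi) * (\<integral>\<^sup>+x. ennreal ((g x)\<^sup>2) \<partial>lborel)"
proof -
  define w where "w = (\<lambda>\<xi>::real. exp (- \<xi>\<^sup>2 / (2 * n\<^sup>2)))"
  define k where "k = (\<lambda>z. 2 * pi * normal_density 0 (1 / n) z)"
  have [measurable]: "g \<in> borel_measurable borel" "w \<in> borel_measurable borel"
      "k \<in> borel_measurable borel" "cis \<in> borel_measurable borel" "cnj \<in> borel_measurable borel"
    using int by (auto simp: w_def k_def intro!: borel_measurable_continuous_onI continuous_intros)
  have int': "integrable lborel (\<lambda>x. complex_of_real (g x) * cis (\<xi> * x))" for \<xi>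
    by (rule Bochner_Integration.integrable_bound[OF int]) (auto simp: norm_mult)
  have [measurable]: "\<phi> \<in> borel_measurable borel" unfolding \<phi>_def by measurable
  define C where "C = (LINT x|lborel. g x)"
  have \<phi>_bound: "cmod (\<phi> \<xi>) \<le> C" for \<xi>
    unfolding \<phi>_def C_def
    by (rule order_trans[OF integral_norm_bound]) (simp add: norm_mult nn)
  have w_int: "integrable lborel w"
  proof -
    have "w = (\<lambda>\<xi>. sqrt (2 * pi * n\<^sup>2) * normal_density 0 n \<xi>)"
      using n by (auto simp: w_def normal_density_def)
    then show ?thesis using n by simp
  qed
  have w_nn: "0 \<le> w \<xi>" for \<xi> by (simp add: w_def)
  \<comment> \<open>Domination by a multiple of w(\<xi>) g(x), a product of integrable functions,
    justifies both exchanges of integrals below: with \<open>D = 1\<close> when \<phi> is expanded,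
    and with \<open>D = C\<close>, the bound of \<phi>, when it is kept as a factor.\<close>
  have prod_int: "integrable (lborel \<Otimes>\<^sub>M lborel) (\<lambda>(x, \<xi>). f x \<xi>)"
    if [measurable]: "(\<lambda>(x, \<xi>). f x \<xi>) \<in> borel_measurable (lborel \<Otimes>\<^sub>M lborel)"
      and b: "\<And>x \<xi>. cmod (f x \<xi>) \<le> D * w \<xi> * g x" for f :: "real \<Rightarrow> real \<Rightarrow> complex" and D
  proof -
    have i: "integrable lborel (\<lambda>\<xi>. f x \<xi>)" for x
      by (rule Bochner_Integration.integrable_bound[where f = "\<lambda>\<xi>. g x * D * w \<xi>"])
        (use b[of x] w_int in \<open>auto simp: mult_ac intro!: AE_I2 order_trans[OF _ abs_ge_self]\<close>)
    show ?thesis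
    proof (rule lborel_pair.Fubini_integrable)
      have "(LINT \<xi>|lborel. cmod (f x \<xi>)) \<le> g x * D * (LINT \<xi>|lborel. w \<xi>)" for x
      proof -
        have "(LINT \<xi>|lborel. cmod (f x \<xi>)) \<le> (LINT \<xi>|lborel. g x * D * w \<xi>)"
          by (rule integral_mono) (use i b[of x] w_int in \<open>auto simp: mult_ac\<close>)
        then show ?thesis by simp
      qed
      then show "integrable lborel (\<lambda>x. LINT y|lborel. cmod (case (x, y) of (x, \<xi>) \<Rightarrow> f x \<xi>))"
        by - (rule Bochner_Integration.integrable_bound[where f = "\<lambda>x. g x * D * (LINT \<xi>|lborel. w \<xi>)"],
          use int in \<open>auto intro!: order_trans[OF _ abs_ge_self]\<close>)
    qed (use i in auto)
  qed
  \<comment> \<open>The inverse transform of the weighted conjugate is the convolution of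
    \<open>g\<close> with \<open>k\<close>, the transform of the weight.\<close>
  have inner: "(LINT \<xi>|lborel. complex_of_real (w \<xi>) * cnj (\<phi> \<xi>) * cis (\<xi> * x)) =
      complex_of_real (LINT y|lborel. g y * k (x - y))" for x
  proof -
    let ?f = "\<lambda>y \<xi>. complex_of_real (w \<xi>) * cis (\<xi> * x) * (complex_of_real (g y) * cis (- (\<xi> * y)))"
    have "(LINT \<xi>|lborel. complex_of_real (w \<xi>) * cnj (\<phi> \<xi>) * cis (\<xi> * x)) =
        (LINT \<xi>|lborel. LINT y|lborel. ?f y \<xi>)"
    proof (rule Bochner_Integration.integral_cong[OF refl])
      fix \<xi>
      have "cnj (\<phi> \<xi>) = (LINT y|lborel. complex_of_real (g y) * cis (- (\<xi> * y)))"
        unfolding \<phi>_def by (subst Bochner_Integration.integral_cnj[symmetric]) (simp add: cis_cnj)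
      then show "complex_of_real (w \<xi>) * cnj (\<phi> \<xi>) * cis (\<xi> * x) = (LINT y|lborel. ?f y \<xi>)"
        by simp
    qed
    also have "\<dots> = (LINT y|lborel. LINT \<xi>|lborel. ?f y \<xi>)"
      by (rule lborel_pair.Fubini_integral[OF prod_int[where D = 1]]) (auto simp: norm_mult w_nn nn)
    also have "\<dots> = (LINT y|lborel. complex_of_real (g y * k (x - y)))"
    proof (rule Bochner_Integration.integral_cong[OF refl])
      fix y
      have "(LINT \<xi>|lborel. ?f y \<xi>) =
          (LINT \<xi>|lborel. complex_of_real (g y) * (complex_of_real (w \<xi>) * cis (\<xi> * (x - y))))"
        by (rule Bochner_Integration.integral_cong)
          (auto simp: mult_ac cis_mult right_diff_distrib)
      also have "\<dots> = complex_of_real (g y * k (x - y))"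
        unfolding w_def k_def using gaussian_fourier[OF n, of "x - y"] by simp
      finally show "(LINT \<xi>|lborel. ?f y \<xi>) = complex_of_real (g y * k (x - y))" .
    qed
    also have "\<dots> = complex_of_real (LINT y|lborel. g y * k (x - y))"
      by (rule integral_complex_of_real)
    finally show ?thesis .
  qed
  have int_sq: "integrable lborel (\<lambda>\<xi>. w \<xi> * (cmod (\<phi> \<xi>))\<^sup>2)"
    by (rule Bochner_Integration.integrable_bound[where f = "\<lambda>\<xi>. w \<xi> * C\<^sup>2"])
      (use w_int in \<open>auto simp: abs_mult w_nn intro!: mult_left_mono power_mono \<phi>_bound\<close>)
  have \<phi>_eq: "(LINT x|lborel. complex_of_real (g x) * cis (\<xi> * x)) = \<phi> \<xi>" for \<xi>
    by (simp add: \<phi>_def)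
  \<comment> \<open>One factor of |\<phi>|^2 = cnj \<phi> * \<phi> is expanded as an integral over
    \<open>x\<close>; the other is kept for \<open>inner\<close>.\<close>
  have "complex_of_real (LINT \<xi>|lborel. w \<xi> * (cmod (\<phi> \<xi>))\<^sup>2) =
      (LINT \<xi>|lborel. LINT x|lborel. complex_of_real (w \<xi>) * cnj (\<phi> \<xi>) * (complex_of_real (g x) * cis (\<xi> * x)))"
    unfolding integral_mult_right_zero \<phi>_eq integral_complex_of_real[symmetric]
    by (simp add: complex_norm_square mult_ac del: of_real_power)
  also have "\<dots> = (LINT x|lborel. LINT \<xi>|lborel. complex_of_real (w \<xi>) * cnj (\<phi> \<xi>) * (complex_of_real (g x) * cis (\<xi> * x)))"
  proof (rule lborel_pair.Fubini_integral[OF prod_int[where D = C]])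
    show "cmod (complex_of_real (w \<xi>) * cnj (\<phi> \<xi>) * (complex_of_real (g x) * cis (\<xi> * x)))
        \<le> C * w \<xi> * g x" for x \<xi>
      using mult_right_mono[OF \<phi>_bound[of \<xi>], of "w \<xi> * g x"]
      by (simp add: norm_mult w_nn nn mult_ac)
  qed measurable
  also have "\<dots> = (LINT x|lborel. complex_of_real (g x * (LINT y|lborel. g y * k (x - y))))"
  proof (rule Bochner_Integration.integral_cong[OF refl])
    fix x
    have "(LINT \<xi>|lborel. complex_of_real (w \<xi>) * cnj (\<phi> \<xi>) * (complex_of_real (g x) * cis (\<xi> * x))) =
        (LINT \<xi>|lborel. complex_of_real (g x) * (complex_of_real (w \<xi>) * cnj (\<phi> \<xi>) * cis (\<xi> * x)))"
      by (simp only: mult_ac)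
    also have "\<dots> = complex_of_real (g x * (LINT y|lborel. g y * k (x - y)))"
      by (subst integral_mult_right_zero) (simp add: inner)
    finally show "(LINT \<xi>|lborel. complex_of_real (w \<xi>) * cnj (\<phi> \<xi>) * (complex_of_real (g x) * cis (\<xi> * x))) =
      complex_of_real (g x * (LINT y|lborel. g y * k (x - y)))" .
  qed
  finally have eq: "(LINT \<xi>|lborel. w \<xi> * (cmod (\<phi> \<xi>))\<^sup>2) =
      (LINT x|lborel. g x * (LINT y|lborel. g y * k (x - y)))"
    unfolding integral_complex_of_real by (simp only: of_real_eq_iff)
  have k_nn: "0 \<le> k z" for z by (simp add: k_def)
  have "(\<integral>\<^sup>+\<xi>. ennreal (w \<xi> * (cmod (\<phi> \<xi>))\<^sup>2) \<partial>lborel) =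
      ennreal (LINT x|lborel. g x * (LINT y|lborel. g y * k (x - y)))"
    unfolding eq[symmetric] by (rule nn_integral_eq_integral[OF int_sq]) (simp add: w_nn)
  \<comment> \<open>From here the estimate runs in [0, infinity], so \<open>g\<close> may fail to be
    square integrable.\<close>
  also have "\<dots> \<le> (\<integral>\<^sup>+x. ennreal (g x * (LINT y|lborel. g y * k (x - y))) \<partial>lborel)"
    by (rule ennreal_integral_le_nn_integral) (simp add: nn k_nn)
  also have "\<dots> \<le> (\<integral>\<^sup>+x. \<integral>\<^sup>+y. ennreal (g x * (g y * k (x - y))) \<partial>lborel \<partial>lborel)"
  proof (rule nn_integral_mono)
    fix x
    have "ennreal (g x * (LINT y|lborel. g y * k (x - y))) =
        ennreal (g x) * ennreal (LINT y|lborel. g y * k (x - y))"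
      by (simp add: nn ennreal_mult')
    also have "\<dots> \<le> ennreal (g x) * (\<integral>\<^sup>+y. ennreal (g y * k (x - y)) \<partial>lborel)"
      by (intro mult_left_mono ennreal_integral_le_nn_integral) (simp_all add: nn k_nn)
    also have "\<dots> = (\<integral>\<^sup>+y. ennreal (g x * (g y * k (x - y))) \<partial>lborel)"
      by (simp add: nn ennreal_mult' nn_integral_cmult)
    finally show "ennreal (g x * (LINT y|lborel. g y * k (x - y)))
        \<le> (\<integral>\<^sup>+y. ennreal (g x * (g y * k (x - y))) \<partial>lborel)" .
  qed
  also have "\<dots> = (\<integral>\<^sup>+x. \<integral>\<^sup>+y. ennreal (2 * pi) *
      ennreal (g x * g y * normal_density 0 (1 / n) (x - y)) \<partial>lborel \<partial>lborel)"
    by (intro nn_integral_cong) (simp add: k_def mult_ac flip: ennreal_mult')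
  also have "\<dots> = ennreal (2 * pi) *
      (\<integral>\<^sup>+x. \<integral>\<^sup>+y. ennreal (g x * g y * normal_density 0 (1 / n) (x - y)) \<partial>lborel \<partial>lborel)"
    by (simp add: nn_integral_cmult)
  also have "\<dots> \<le> ennreal (2 * pi) * (\<integral>\<^sup>+x. ennreal ((g x)\<^sup>2) \<partial>lborel)"
    using n by (intro mult_left_mono nn_integral_normal_quadratic_form_le) auto
  finally show ?thesis unfolding w_def .
qed

text \<open>The weighted bound is uniform in the width of the Gaussian weight. The weight tends to 1
  pointwise as the width grows, and Fatou's lemma removes it.\<close>

lemma fourier_plancherel_le:
  fixes g :: "real \<Rightarrow> real"
  assumes int: "integrable lborel g" and nn: "\<And>x. 0 \<le> g x"
  defines "\<phi> \<equiv> \<lambda>\<xi>. LINT x|lborel. complex_of_real (g x) * cis (\<xi> * x)"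
  shows "(\<integral>\<^sup>+\<xi>. ennreal ((cmod (\<phi> \<xi>))\<^sup>2) \<partial>lborel) \<le> ennreal (2 * pi) * (\<integral>\<^sup>+x. ennreal ((g x)\<^sup>2) \<partial>lborel)"
proof -
  \<comment> \<open>\<open>Suc n\<close> keeps the width positive, as the weighted bound
    requires.\<close>
  define w where "w = (\<lambda>n::nat. \<lambda>\<xi>::real. exp (- \<xi>\<^sup>2 / (2 * (real (Suc n))\<^sup>2)))"
  have [measurable]: "g \<in> borel_measurable borel" "cis \<in> borel_measurable borel"
    using int by (auto intro!: borel_measurable_continuous_onI continuous_intros)
  have [measurable]: "\<phi> \<in> borel_measurable borel" unfolding \<phi>_def by measurable
  have [measurable]: "w n \<in> borel_measurable borel" for n unfolding w_def by measurable
  have lim: "(\<lambda>n. w n \<xi>) \<longlonglongrightarrow> 1" for \<xi>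
  proof -
    have "filterlim (\<lambda>n. real (Suc n)) at_top sequentially"
      by (rule filterlim_compose[OF filterlim_real_sequentially filterlim_Suc])
    then have "filterlim (\<lambda>n. (real (Suc n))\<^sup>2) at_top sequentially"
      by (rule filterlim_pow_at_top[rotated]) simp
    then have "(\<lambda>n. inverse ((real (Suc n))\<^sup>2)) \<longlonglongrightarrow> 0"
      by (rule tendsto_inverse_0_at_top)
    from tendsto_mult_left[OF this, of "- \<xi>\<^sup>2 / 2"] have "(\<lambda>n. - \<xi>\<^sup>2 / (2 * (real (Suc n))\<^sup>2)) \<longlonglongrightarrow> 0"
      by (simp add: field_simps del: of_nat_Suc)
    then show ?thesis unfolding w_def using tendsto_exp by fastforce
  qed
  have "(\<integral>\<^sup>+\<xi>. ennreal ((cmod (\<phi> \<xi>))\<^sup>2) \<partial>lborel) =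
      (\<integral>\<^sup>+\<xi>. liminf (\<lambda>n. ennreal (w n \<xi> * (cmod (\<phi> \<xi>))\<^sup>2)) \<partial>lborel)"
  proof (rule nn_integral_cong)
    fix \<xi>
    have "(\<lambda>n. ennreal (w n \<xi> * (cmod (\<phi> \<xi>))\<^sup>2)) \<longlonglongrightarrow> ennreal ((cmod (\<phi> \<xi>))\<^sup>2)"
      using tendsto_mult_right[OF lim[of \<xi>], of "(cmod (\<phi> \<xi>))\<^sup>2"] by (intro tendsto_ennrealI) simp
    then show "ennreal ((cmod (\<phi> \<xi>))\<^sup>2) = liminf (\<lambda>n. ennreal (w n \<xi> * (cmod (\<phi> \<xi>))\<^sup>2))"
      using lim_imp_Liminf sequentially_bot by metis
  qed
  also have "\<dots> \<le> liminf (\<lambda>n. \<integral>\<^sup>+\<xi>. ennreal (w n \<xi> * (cmod (\<phi> \<xi>))\<^sup>2) \<partial>lborel)"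
    by (rule nn_integral_liminf) measurable
  also have "\<dots> \<le> ennreal (2 * pi) * (\<integral>\<^sup>+x. ennreal ((g x)\<^sup>2) \<partial>lborel)"
  proof -
    have "(\<integral>\<^sup>+\<xi>. ennreal (w n \<xi> * (cmod (\<phi> \<xi>))\<^sup>2) \<partial>lborel)
        \<le> ennreal (2 * pi) * (\<integral>\<^sup>+x. ennreal ((g x)\<^sup>2) \<partial>lborel)" for n
      unfolding w_def \<phi>_def by (rule fourier_gaussian_weight_le[OF int nn]) simp
    then have "liminf (\<lambda>n. \<integral>\<^sup>+\<xi>. ennreal (w n \<xi> * (cmod (\<phi> \<xi>))\<^sup>2) \<partial>lborel)
        \<le> liminf (\<lambda>n::nat. ennreal (2 * pi) * (\<integral>\<^sup>+x. ennreal ((g x)\<^sup>2) \<partial>lborel))"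
      by (intro Liminf_mono always_eventually allI)
    then show ?thesis by (simp add: Liminf_const)
  qed
  finally show ?thesis .
qed

text \<open>Both measures give a box its side length, because \<open>Basis\<close> is the singleton
  of \<open>b\<close>. This carries real-line results over to \<open>'a\<close>, which is only known
  to have dimension one.\<close>

lemma lborel_one_dim:
  assumes "DIM('a) = 1" and "b \<in> (Basis :: 'a::euclidean_space set)"
  shows "(lborel :: 'a measure) = distr lborel borel (\<lambda>r. r *\<^sub>R b)"
proof (rule lborel_eqI)
  have B: "Basis = {b}" using assms by (metis card_1_singletonE singletonD)
  fix l u :: 'a assume le: "\<And>c. c \<in> Basis \<Longrightarrow> l \<bullet> c \<le> u \<bullet> c"
  have "(\<lambda>r. r *\<^sub>R b) -` box l u = {l \<bullet> b<..<u \<bullet> b}"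
    using assms by (auto simp: box_def B)
  then show "emeasure (distr lborel borel (\<lambda>r. r *\<^sub>R b)) (box l u) = (\<Prod>c\<in>Basis. (u - l) \<bullet> c)"
    using le[of b] assms by (subst emeasure_distr) (auto simp: B inner_diff_left)
qed simp

text \<open>The squared transform enters through a separate function \<open>f\<close>, so that the
  explicit exponential of the stable kernel can be inserted together with its own
  measurability.\<close>

lemma fourier_plancherel_le_one_dim:
  fixes g :: "'a::euclidean_space \<Rightarrow> real"
  assumes dim: "DIM('a) = 1" and int: "integrable lborel g" and nn: "\<And>x. 0 \<le> g x"
    and [measurable]: "f \<in> borel_measurable borel"
    and f: "\<And>\<xi>. f \<xi> = ennreal ((cmod (LINT x|lborel. complex_of_real (g x) * cis (\<xi> \<bullet> x)))\<^sup>2)"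
  shows "(\<integral>\<^sup>+\<xi>. f \<xi> \<partial>lborel) \<le> ennreal (2 * pi) * (\<integral>\<^sup>+x. ennreal ((g x)\<^sup>2) \<partial>lborel)"
proof -
  obtain b :: 'a where b: "b \<in> Basis" using nonempty_Basis by blast
  note L = lborel_one_dim[OF dim b]
  have [measurable]: "g \<in> borel_measurable borel" "cis \<in> borel_measurable borel"
    using int by (auto intro!: borel_measurable_continuous_onI continuous_intros)
  have b1: "b \<bullet> b = 1" using b by (simp add: inner_Basis)
  have "integrable lborel (\<lambda>r. g (r *\<^sub>R b))"
    using int unfolding L by (simp add: integrable_distr_eq)
  from fourier_plancherel_le[OF this] nn
  have "(\<integral>\<^sup>+s. ennreal ((cmod (LINT r|lborel. complex_of_real (g (r *\<^sub>R b)) * cis (s * r)))\<^sup>2) \<partial>lborel)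
      \<le> ennreal (2 * pi) * (\<integral>\<^sup>+r. ennreal ((g (r *\<^sub>R b))\<^sup>2) \<partial>lborel)" by simp
  moreover have "f (s *\<^sub>R b) =
      ennreal ((cmod (LINT r|lborel. complex_of_real (g (r *\<^sub>R b)) * cis (s * r)))\<^sup>2)" for s
    unfolding f L by (subst integral_distr) (simp_all add: b1 mult.commute)
  ultimately show ?thesis
    unfolding L by (simp add: nn_integral_distr)
qed

section \<open>The Laplace transform of the energy, and \<open>Upsilon\<close> near zero\<close>

lemma nn_integral_exp_neg:
  fixes c :: real
  assumes "0 < c"
  shows "(\<integral>\<^sup>+t\<in>{0<..}. ennreal (exp (- (c * t))) \<partial>lborel) = ennreal (1 / c)"
proof -
  have "(\<integral>\<^sup>+t\<in>{0<..}. ennreal (exp (- (c * t))) \<partial>lborel) =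
      (\<integral>\<^sup>+t. ennreal (exp (- (c * t))) * indicator {0..} t \<partial>lborel)"
    \<comment> \<open>The fundamental theorem is applied on the closed half-line; the added point 0
      is a null set.\<close>
    by (rule nn_integral_cong_AE)
      (use AE_lborel_singleton[of "0::real"] in \<open>eventually_elim; auto split: split_indicator\<close>)
  also have "\<dots> = ennreal (0 - (- exp (- (c * 0)) / c))"
  proof (rule nn_integral_FTC_atLeast)
    have "filterlim (\<lambda>t. - (c * t)) at_bot at_top"
      using filterlim_tendsto_pos_mult_at_top[OF tendsto_const assms filterlim_ident]
      by (simp add: filterlim_uminus_at_bot)
    from tendsto_divide[OF tendsto_minus[OF filterlim_compose[OF exp_at_bot this]] tendsto_const[of c]]
    have "((\<lambda>t. - exp (- (c * t)) / c) \<longlongrightarrow> - 0 / c) at_top"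
      using assms by simp
    then show "((\<lambda>t. - exp (- (c * t)) / c) \<longlongrightarrow> 0) at_top" by simp
  qed (use assms in \<open>auto intro!: derivative_eq_intros\<close>)
  finally show ?thesis by simp
qed

text \<open>Plancherel at each fixed \<open>t\<close> bounds the energy below by 1/(2 pi) times the
  integral of exp(-2 t \<nu> |\<xi>|^\<alpha>). Tonelli then exchanges time and frequency, and the
  time integral of exp(-(l + 2 \<nu> |\<xi>|^\<alpha>) t) is the integrand of
  \<open>Upsilon\<close>.\<close>

lemma Upsilon_le_laplace:
  fixes G :: "real \<Rightarrow> 'a::euclidean_space \<Rightarrow> real"
  assumes dim: "DIM('a) = 1" and G: "stable_transition_density \<nu> \<alpha> G" and "0 < \<nu>" "0 < l"
  shows "Upsilon TYPE('a) \<nu> \<alpha> l \<le>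
    (\<integral>\<^sup>+t\<in>{0<..}. ennreal (exp (- (l * t))) * (\<integral>\<^sup>+y. ennreal ((G t y)\<^sup>2) \<partial>lborel) \<partial>lborel)"
proof -
  let ?p = "\<lambda>\<xi>::'a. norm \<xi> powr \<alpha>"
  let ?e = "\<lambda>t (\<xi>::'a). ennreal (exp (- (2 * t * \<nu> * ?p \<xi>)))"
  have b: "ennreal (1 / (2 * pi)) * (\<integral>\<^sup>+\<xi>. ?e t \<xi> \<partial>lborel) \<le> (\<integral>\<^sup>+y. ennreal ((G t y)\<^sup>2) \<partial>lborel)"
    if "0 < t" for t
  proof -
    have "(\<integral>\<^sup>+\<xi>. ?e t \<xi> \<partial>lborel) \<le> ennreal (2 * pi) * (\<integral>\<^sup>+x. ennreal ((G t x)\<^sup>2) \<partial>lborel)"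
      using G \<open>0 < t\<close> unfolding stable_transition_density_def
      by (intro fourier_plancherel_le_one_dim[OF dim])
        (simp_all add: power2_eq_square flip: exp_add of_real_mult)
    from mult_left_mono[OF this, of "ennreal (1 / (2 * pi))"] show ?thesis
      by (simp add: mult.assoc[symmetric] flip: ennreal_mult')
  qed
  have pt: "(\<integral>\<^sup>+t. indicator {0<..} t * ennreal (exp (- (l * t))) * ?e t \<xi> \<partial>lborel) =
      ennreal (1 / (l + 2 * \<nu> * ?p \<xi>))" for \<xi> :: 'a
  proof -
    have "0 < l + 2 * \<nu> * ?p \<xi>" using assms by (simp add: add_pos_nonneg)
    note nn_integral_exp_neg[OF this]
    moreover have "ennreal (exp (- (l * t))) * ?e t \<xi> = ennreal (exp (- ((l + 2 * \<nu> * ?p \<xi>) * t)))" for t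
    proof -
      have "- (l * t) + - (2 * t * \<nu> * ?p \<xi>) = - ((l + 2 * \<nu> * ?p \<xi>) * t)" by algebra
      then show ?thesis by (simp only: ennreal_mult'[symmetric] exp_ge_zero exp_add[symmetric])
    qed
    then have "indicator {0<..} t * ennreal (exp (- (l * t))) * ?e t \<xi> =
        ennreal (exp (- ((l + 2 * \<nu> * ?p \<xi>) * t))) * indicator {0<..} t" for t
      by (metis mult.assoc mult.commute)
    ultimately show ?thesis by (simp only:)
  qed
  have "Upsilon TYPE('a) \<nu> \<alpha> l = ennreal (1 / (2 * pi)) *
      (\<integral>\<^sup>+\<xi>. \<integral>\<^sup>+t. indicator {0<..} t * ennreal (exp (- (l * t))) * ?e t \<xi> \<partial>lborel \<partial>lborel)"
    unfolding Upsilon_def pt ..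
  also have "(\<integral>\<^sup>+\<xi>. \<integral>\<^sup>+t. indicator {0<..} t * ennreal (exp (- (l * t))) * ?e t \<xi> \<partial>lborel \<partial>lborel) =
      (\<integral>\<^sup>+t. \<integral>\<^sup>+\<xi>. indicator {0<..} t * ennreal (exp (- (l * t))) * ?e t \<xi> \<partial>lborel \<partial>lborel)"
    by (rule lborel_pair.Fubini') measurable
  also have "ennreal (1 / (2 * pi)) * \<dots> = (\<integral>\<^sup>+t. ennreal (1 / (2 * pi)) *
      (\<integral>\<^sup>+\<xi>. indicator {0<..} t * ennreal (exp (- (l * t))) * ?e t \<xi> \<partial>lborel) \<partial>lborel)"
    by (rule nn_integral_cmult[symmetric]) measurable
  also have "\<dots> = (\<integral>\<^sup>+t\<in>{0<..}. ennreal (exp (- (l * t))) * (ennreal (1 / (2 * pi)) * (\<integral>\<^sup>+\<xi>. ?e t \<xi> \<partial>lborel)) \<partial>lborel)"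
    by (rule nn_integral_cong) (simp add: nn_integral_cmult mult_ac)
  also have "\<dots> \<le> (\<integral>\<^sup>+t\<in>{0<..}. ennreal (exp (- (l * t))) * (\<integral>\<^sup>+y. ennreal ((G t y)\<^sup>2) \<partial>lborel) \<partial>lborel)"
    using b by (intro nn_integral_mono) (auto split: split_indicator intro!: mult_left_mono)
  finally show ?thesis .
qed

text \<open>On |\<xi>| \<le> R with l = R^\<alpha> the integrand is at least 1/(l (1 + 2 \<nu>)).
  The interval of length 2 R thus contributes R^(1 - \<alpha>) / (pi (1 + 2 \<nu>)) to
  \<open>Upsilon\<close>, which is unbounded as R tends to 0 because \<alpha> > 1.\<close>

lemma Upsilon_gt:
  assumes dim: "DIM('a::euclidean_space) = 1" and "1 < \<alpha>" "0 < \<nu>" "0 \<le> r"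
  obtains l where "0 < l" "Upsilon TYPE('a) \<nu> \<alpha> l > ennreal r"
proof -
  obtain b :: 'a where b: "b \<in> Basis" using nonempty_Basis by blast
  note L = lborel_one_dim[OF dim b]
  \<comment> \<open>\<open>X\<close> is the value of R^(1 - \<alpha>) at which the lower bound
    exceeds \<open>r\<close>, the summand 1 making this strict; \<open>R\<close> is then solved from
    it.\<close>
  define X where "X = r * (pi * (1 + 2 * \<nu>)) + 1"
  have X: "0 < X" using assms by (auto simp: X_def intro!: add_nonneg_pos)
  define R where "R = X powr (1 / (1 - \<alpha>))"
  have R: "0 < R" using X by (simp add: R_def)
  have RX: "R powr (1 - \<alpha>) = X"
    using assms X by (simp add: R_def powr_powr)
  define l where "l = R powr \<alpha>"
  have l: "0 < l" using R by (simp add: l_def)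
  have "ennreal (2 * R / (l * (1 + 2 * \<nu>))) = (\<integral>\<^sup>+s. ennreal (1 / (l * (1 + 2 * \<nu>))) * indicator {-R..R} s \<partial>lborel)"
    using R l assms by (simp add: nn_integral_cmult flip: ennreal_mult')
  also have "\<dots> \<le> (\<integral>\<^sup>+s. ennreal (1 / (l + 2 * \<nu> * \<bar>s\<bar> powr \<alpha>)) \<partial>lborel)"
  proof (rule nn_integral_mono)
    fix s
    have "1 / (l * (1 + 2 * \<nu>)) \<le> 1 / (l + 2 * \<nu> * \<bar>s\<bar> powr \<alpha>)" if "s \<in> {-R..R}"
    proof (rule divide_left_mono)
      have "\<bar>s\<bar> powr \<alpha> \<le> l" unfolding l_def using that assms by (intro powr_mono2) auto
      then show "l + 2 * \<nu> * \<bar>s\<bar> powr \<alpha> \<le> l * (1 + 2 * \<nu>)"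
        using \<open>0 < \<nu>\<close> by (simp add: algebra_simps)
    qed (use l assms in \<open>auto intro!: mult_pos_pos add_pos_nonneg\<close>)
    then show "ennreal (1 / (l * (1 + 2 * \<nu>))) * indicator {-R..R} s \<le> ennreal (1 / (l + 2 * \<nu> * \<bar>s\<bar> powr \<alpha>))"
      by (auto split: split_indicator intro!: ennreal_leI)
  qed
  also have "\<dots> = (\<integral>\<^sup>+(\<xi>::'a). ennreal (1 / (l + 2 * \<nu> * norm \<xi> powr \<alpha>)) \<partial>lborel)"
    unfolding L using b by (simp add: nn_integral_distr)
  finally have "ennreal (1 / (2 * pi)) * ennreal (2 * R / (l * (1 + 2 * \<nu>))) \<le> Upsilon TYPE('a) \<nu> \<alpha> l"
    unfolding Upsilon_def by (rule mult_left_mono) simp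
  moreover have "ennreal (1 / (2 * pi)) * ennreal (2 * R / (l * (1 + 2 * \<nu>))) = ennreal (X / (pi * (1 + 2 * \<nu>)))"
  proof -
    have "X = R / l" using R unfolding RX[symmetric] l_def by (simp add: powr_diff)
    then have "1 / (2 * pi) * (2 * R / (l * (1 + 2 * \<nu>))) = X / (pi * (1 + 2 * \<nu>))" by simp
    then show ?thesis by (metis ennreal_mult' zero_le_divide_1_iff pi_ge_zero mult_nonneg_nonneg zero_le_numeral)
  qed
  moreover have "r < X / (pi * (1 + 2 * \<nu>))"
  proof -
    have "0 < pi * (1 + 2 * \<nu>)" using \<open>0 < \<nu>\<close> by simp
    then show ?thesis unfolding X_def by (subst pos_less_divide_eq) simp_all
  qed
  ultimately have "ennreal r < Upsilon TYPE('a) \<nu> \<alpha> l"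
    using assms by (metis ennreal_lessI le_less_trans less_le_trans order_less_imp_le)
  with l show thesis by (rule that)
qed

section \<open>Moments and independence of Poisson counts\<close>

text \<open>The recursion (k + 1) p(k + 1) = m p(k) reduces the first two factorial moments to the
  total mass.\<close>

lemma poisson_weight_sums:
  fixes m :: real
  defines "p \<equiv> \<lambda>k. exp (- m) * m ^ k / fact k"
  shows "p sums 1" and "(\<lambda>k. real k * p k) sums m" and "(\<lambda>k. (real k - m)\<^sup>2 * p k) sums m"
proof -
  have e: "(\<lambda>k. m ^ k / fact k) sums exp m"
    using exp_converges[of m] by (simp add: divide_inverse mult.commute)
  show 0: "p sums 1"
    using sums_mult[OF e, of "exp (- m)"] by (simp add: p_def exp_minus)
  have "(\<lambda>k. real (Suc k) * p (Suc k)) = (\<lambda>k. m * p k)"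
    by (simp add: p_def fun_eq_iff field_simps del: of_nat_Suc)
  then have "(\<lambda>k. real (Suc k) * p (Suc k)) sums (m * 1)"
    using sums_mult[OF 0, of m] by simp
  from sums_Suc[OF this] show 1: "(\<lambda>k. real k * p k) sums m" by simp
  have "(\<lambda>k. (real (Suc k) * (real (Suc k) - 1)) * p (Suc k)) = (\<lambda>k. m * (real k * p k))"
    using fun_cong[OF \<open>(\<lambda>k. real (Suc k) * p (Suc k)) = (\<lambda>k. m * p k)\<close>]
    by (simp add: fun_eq_iff mult_ac)
  then have "(\<lambda>k. (real (Suc k) * (real (Suc k) - 1)) * p (Suc k)) sums (m * m)"
    using sums_mult[OF 1, of m] by simp
  from sums_Suc[OF this] have 2: "(\<lambda>k. (real k * (real k - 1)) * p k) sums (m * m)" by simp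
  \<comment> \<open>The square is expanded in factorial moments: (k - m)^2 = k (k - 1) + (1 - 2 m) k
    + m^2.\<close>
  have "(\<lambda>k. (real k * (real k - 1)) * p k + (1 - 2 * m) * (real k * p k) + m\<^sup>2 * p k) sums
      (m * m + (1 - 2 * m) * m + m\<^sup>2 * 1)"
    by (intro sums_add sums_mult 0 1 2)
  moreover have "(real k * (real k - 1)) * p k + (1 - 2 * m) * (real k * p k) + m\<^sup>2 * p k =
      (real k - m)\<^sup>2 * p k" for k
    by (simp add: power2_eq_square algebra_simps)
  ultimately show "(\<lambda>k. (real k - m)\<^sup>2 * p k) sums m"
    by (simp add: power2_eq_square algebra_simps)
qed

locale poisson_noise = prob_space M for M :: "'w measure" +
  fixes \<Lambda> :: "'e measure" and N :: "'w \<Rightarrow> 'e measure"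
  assumes prm: "poisson_random_measure M \<Lambda> N"
begin

lemma sets_count: "\<omega> \<in> space M \<Longrightarrow> sets (N \<omega>) = sets \<Lambda>"
  using prm by (auto simp: poisson_random_measure_def)

lemma count_measurable: "B \<in> sets \<Lambda> \<Longrightarrow> (\<lambda>\<omega>. emeasure (N \<omega>) B) \<in> borel_measurable M"
  using prm by (auto simp: poisson_random_measure_def)

lemma compensated_measurable: "B \<in> sets \<Lambda> \<Longrightarrow> compensated \<Lambda> N B \<in> borel_measurable M"
  unfolding compensated_def[abs_def] measure_def
  by (intro borel_measurable_diff borel_measurable_const measurable_compose[OF count_measurable]) auto

lemma count_distribution:
  assumes "B \<in> sets \<Lambda>" "emeasure \<Lambda> B < \<infinity>"
  shows "measure M {\<omega>\<in>space M. emeasure (N \<omega>) B = of_nat k} =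
    exp (- measure \<Lambda> B) * measure \<Lambda> B ^ k / fact k"
  using prm assms by (auto simp: poisson_random_measure_def)

lemma count_indep:
  fixes B :: "nat \<Rightarrow> 'e set"
  assumes "finite I" "B ` I \<subseteq> sets \<Lambda>" "disjoint_family_on B I"
  shows "indep_vars (\<lambda>_. borel) (\<lambda>i \<omega>. emeasure (N \<omega>) (B i)) I"
  using prm assms by (auto simp: poisson_random_measure_def)

lemma count_level_sets:
  assumes "B \<in> sets \<Lambda>"
  shows "{\<omega>\<in>space M. emeasure (N \<omega>) B = of_nat k} \<in> sets M"
proof -
  have "(\<lambda>\<omega>. emeasure (N \<omega>) B) -` {of_nat k} \<inter> space M \<in> sets M"
    by (rule measurable_sets[OF count_measurable[OF assms]]) simp
  then show ?thesis by (simp add: vimage_def Int_def conj_commute)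
qed

lemma disjoint_count_levels: "disjoint_family (\<lambda>k::nat. {\<omega>\<in>space M. emeasure (N \<omega>) B = of_nat k})"
  by (auto simp: disjoint_family_on_def)

text \<open>The random measure is prescribed only through the probabilities of its integer values.
  As the Poisson weights sum to one, all other values, infinity included, have probability
  zero.\<close>

lemma AE_count_nat:
  assumes B: "B \<in> sets \<Lambda>" "emeasure \<Lambda> B < \<infinity>"
  shows "AE \<omega> in M. \<exists>k::nat. emeasure (N \<omega>) B = of_nat k"
proof -
  let ?E = "\<lambda>k::nat. {\<omega>\<in>space M. emeasure (N \<omega>) B = of_nat k}"
  have "(\<lambda>k. prob (?E k)) sums prob (\<Union>k. ?E k)"
    using count_level_sets[OF B(1)] disjoint_count_levels by (intro finite_measure_UNION) auto
  then have "prob (\<Union>k. ?E k) = 1"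
    using poisson_weight_sums(1)[of "measure \<Lambda> B"] unfolding count_distribution[OF B]
    by (rule sums_unique2)
  then have "AE \<omega> in M. \<omega> \<in> (\<Union>k. ?E k)"
    using count_level_sets[OF B(1)] by (subst prob_eq_1[symmetric]) auto
  then show ?thesis by eventually_elim auto
qed

lemma AE_count_finite:
  assumes "B \<in> sets \<Lambda>" "emeasure \<Lambda> B < \<infinity>"
  shows "AE \<omega> in M. emeasure (N \<omega>) B \<noteq> \<infinity>"
  using AE_count_nat[OF assms] by eventually_elim auto

text \<open>Almost every outcome lies in exactly one level set of the count, so an expectation
  becomes a series against the Poisson weights.\<close>

lemma nn_integral_count:
  assumes B: "B \<in> sets \<Lambda>" "emeasure \<Lambda> B < \<infinity>" and f: "\<And>x. 0 \<le> f x"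
    and s: "(\<lambda>k. f (real k) * (exp (- measure \<Lambda> B) * measure \<Lambda> B ^ k / fact k)) sums c"
  shows "(\<integral>\<^sup>+\<omega>. ennreal (f (measure (N \<omega>) B)) \<partial>M) = ennreal c"
proof -
  let ?E = "\<lambda>k::nat. {\<omega>\<in>space M. emeasure (N \<omega>) B = of_nat k}"
  have "(\<integral>\<^sup>+\<omega>. ennreal (f (measure (N \<omega>) B)) \<partial>M) =
      (\<integral>\<^sup>+\<omega>. (\<Sum>k. ennreal (f (real k)) * indicator (?E k) \<omega>) \<partial>M)"
  proof (rule nn_integral_cong_AE, use AE_count_nat[OF B] AE_space in eventually_elim)
    case (elim \<omega>)
    then obtain k where k: "emeasure (N \<omega>) B = of_nat k" "\<omega> \<in> ?E k" by auto
    have "(\<Sum>j. ennreal (f (real j)) * indicator (?E j) \<omega>) = ennreal (f (real k))"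
      by (rule suminf_cmult_indicator[OF disjoint_count_levels k(2)])
    then show ?case using k by (simp add: measure_def)
  qed
  also have "\<dots> = (\<Sum>k. \<integral>\<^sup>+\<omega>. ennreal (f (real k)) * indicator (?E k) \<omega> \<partial>M)"
    using count_level_sets[OF B(1)] by (intro nn_integral_suminf) auto
  also have "\<dots> = (\<Sum>k. ennreal (f (real k) * (exp (- measure \<Lambda> B) * measure \<Lambda> B ^ k / fact k)))"
    using count_level_sets[OF B(1)]
    by (simp add: nn_integral_cmult_indicator emeasure_eq_measure count_distribution[OF B] f flip: ennreal_mult')
  also have "\<dots> = ennreal c"
    using s f by (intro suminf_ennreal_eq) auto
  finally show ?thesis .
qed

lemma compensated_moments:
  assumes B: "B \<in> sets \<Lambda>" "emeasure \<Lambda> B < \<infinity>"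
  shows "has_bochner_integral M (compensated \<Lambda> N B) 0"
    and "has_bochner_integral M (\<lambda>\<omega>. (compensated \<Lambda> N B \<omega>)\<^sup>2) (measure \<Lambda> B)"
proof -
  note [measurable] = count_measurable[OF B(1)] compensated_measurable[OF B(1)]
  have "(\<integral>\<^sup>+\<omega>. ennreal \<bar>measure (N \<omega>) B\<bar> \<partial>M) = ennreal (measure \<Lambda> B)"
    using poisson_weight_sums(2)[of "measure \<Lambda> B"] by (intro nn_integral_count[OF B]) auto
  then have "has_bochner_integral M (\<lambda>\<omega>. measure (N \<omega>) B) (measure \<Lambda> B)"
    by (intro has_bochner_integral_nn_integral) (auto simp: measure_def)
  from has_bochner_integral_diff[OF this, of "\<lambda>_. measure \<Lambda> B" "measure \<Lambda> B"]
  show "has_bochner_integral M (compensated \<Lambda> N B) 0"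
    by (simp add: compensated_def[abs_def] has_bochner_integral_iff prob_space)
  have "(\<integral>\<^sup>+\<omega>. ennreal ((measure (N \<omega>) B - measure \<Lambda> B)\<^sup>2) \<partial>M) = ennreal (measure \<Lambda> B)"
    using poisson_weight_sums(3)[of "measure \<Lambda> B"] by (intro nn_integral_count[OF B]) auto
  then show "has_bochner_integral M (\<lambda>\<omega>. (compensated \<Lambda> N B \<omega>)\<^sup>2) (measure \<Lambda> B)"
    by (intro has_bochner_integral_nn_integral) (auto simp flip: compensated_def)
qed

text \<open>Additivity can fail where a count is infinite, since \<open>measure\<close> then takes
  its default value 0; this happens with probability zero only.\<close>

lemma AE_compensated_Un:
  assumes "A \<in> sets \<Lambda>" "emeasure \<Lambda> A < \<infinity>" "B \<in> sets \<Lambda>" "emeasure \<Lambda> B < \<infinity>" "A \<inter> B = {}"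
  shows "AE \<omega> in M. compensated \<Lambda> N (A \<union> B) \<omega> = compensated \<Lambda> N A \<omega> + compensated \<Lambda> N B \<omega>"
  using AE_count_finite[OF assms(1,2)] AE_count_finite[OF assms(3,4)] AE_space
proof eventually_elim
  case (elim \<omega>)
  then show ?case
    using assms sets_count[of \<omega>] unfolding compensated_def
    by (simp add: measure_Union less_top)
qed

section \<open>The sigma-algebra of the noise on a set \<open>T\<close>, and its independence of the
  noise off \<open>T\<close>. For \<open>T = {0..t} \<times> UNIV\<close> it is the filtration at
  time \<open>t\<close>\<close>

definition past :: "'e set \<Rightarrow> 'w measure" where
  "past T = sigma (space M) {(\<lambda>\<omega>. emeasure (N \<omega>) B) -` U \<inter> space M | B U.
     B \<in> sets \<Lambda> \<and> B \<subseteq> T \<and> U \<in> sets borel}"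

lemma space_past[simp]: "space (past T) = space M"
  by (simp add: past_def space_measure_of_conv)

lemma sets_past: "sets (past T) = sigma_sets (space M) {(\<lambda>\<omega>. emeasure (N \<omega>) B) -` U \<inter> space M | B U.
     B \<in> sets \<Lambda> \<and> B \<subseteq> T \<and> U \<in> sets borel}"
  unfolding past_def by (rule sets_measure_of) auto

lemma past_mono: "S \<subseteq> T \<Longrightarrow> sets (past S) \<subseteq> sets (past T)"
  unfolding sets_past
proof (rule sigma_sets_mono', safe)
  fix B and U :: "ennreal set" assume "S \<subseteq> T" "B \<in> sets \<Lambda>" "B \<subseteq> S" "U \<in> sets borel"
  moreover from this have "B \<subseteq> T" by blast
  ultimately show "\<exists>B' U'. (\<lambda>\<omega>. emeasure (N \<omega>) B) -` U \<inter> space M = (\<lambda>\<omega>. emeasure (N \<omega>) B') -` U' \<inter> space M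
      \<and> B' \<in> sets \<Lambda> \<and> B' \<subseteq> T \<and> U' \<in> sets borel"
    by (intro exI[of _ B] exI[of _ U] conjI refl)
qed

lemma sets_past_subset: "sets (past T) \<subseteq> sets M"
  unfolding sets_past
proof (rule sets.sigma_sets_subset, safe)
  fix B and U :: "ennreal set" assume "B \<in> sets \<Lambda>" "U \<in> sets borel"
  then show "(\<lambda>\<omega>. emeasure (N \<omega>) B) -` U \<inter> space M \<in> sets M"
    by (rule measurable_sets[OF count_measurable])
qed

lemma past_measurable_mono:
  "f \<in> borel_measurable (past S) \<Longrightarrow> S \<subseteq> T \<Longrightarrow> f \<in> borel_measurable (past T)"
  by (erule measurable_from_subalg[rotated]) (auto simp only: subalgebra_def space_past intro: past_mono[THEN subsetD])

lemma past_measurable: "f \<in> borel_measurable (past S) \<Longrightarrow> f \<in> borel_measurable M"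
  by (erule measurable_from_subalg[rotated]) (simp only: subalgebra_def space_past sets_past_subset simp_thms)

lemma count_past_measurable:
  assumes "B \<in> sets \<Lambda>" "B \<subseteq> T"
  shows "(\<lambda>\<omega>. emeasure (N \<omega>) B) \<in> borel_measurable (past T)"
proof (rule measurableI)
  fix U :: "ennreal set" assume "U \<in> sets borel"
  then show "(\<lambda>\<omega>. emeasure (N \<omega>) B) -` U \<inter> space (past T) \<in> sets (past T)"
    unfolding sets_past space_past using assms by (intro sigma_sets.Basic) blast
qed simp

lemma prob_past_event_mult:
  assumes Q: "finite Q" "\<And>B U. (B, U) \<in> Q \<Longrightarrow> B \<in> sets \<Lambda> \<and> B \<subseteq> T \<and> U \<in> sets borel"
    and C: "C \<in> sets \<Lambda>" "C \<inter> T = {}" and V: "V \<in> sets borel"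
  shows "prob ({\<omega>\<in>space M. \<forall>(B, U)\<in>Q. emeasure (N \<omega>) B \<in> U} \<inter> {\<omega>\<in>space M. emeasure (N \<omega>) C \<in> V}) =
    prob {\<omega>\<in>space M. \<forall>(B, U)\<in>Q. emeasure (N \<omega>) B \<in> U} * prob {\<omega>\<in>space M. emeasure (N \<omega>) C \<in> V}"
proof -
  (* The nonempty atoms of the algebra generated by the first components of Q, together with C, form
     a disjoint family, to which the independence of the noise applies. *)
  define \<B> where "\<B> = fst ` Q"
  have \<B>: "finite \<B>" "B \<in> \<B> \<Longrightarrow> B \<in> sets \<Lambda> \<and> B \<subseteq> T" for B
    using Q unfolding \<B>_def by (simp, metis (no_types, lifting) imageE prod.collapse)
  \<comment> \<open>The existential condition empties the atom labelled by the empty set. That atom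
    would otherwise be the complement of all sets in \<B> and could meet \<open>C\<close>.\<close>
  define atom where "atom = (\<lambda>S. {x\<in>space \<Lambda>. (\<exists>B\<in>\<B>. x \<in> B) \<and> (\<forall>B\<in>\<B>. x \<in> B \<longleftrightarrow> B \<in> S)})"
  obtain e where e: "bij_betw e {0..<card (Pow \<B>)} (Pow \<B>)"
    using ex_bij_betw_nat_finite \<B>(1) by blast
  define n where "n = card (Pow \<B>)"
  have inj: "inj_on e {0..<n}" and im: "e ` {0..<n} = Pow \<B>"
    using e by (simp_all add: n_def bij_betw_def)
  define D where "D = (\<lambda>k. if k < n then atom (e k) else C)"
  have atom_sets: "atom S \<in> sets \<Lambda>" for S
  proof -
    have "{x \<in> space \<Lambda>. x \<in> B} \<in> sets \<Lambda>" if "B \<in> \<B>" for B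
      using \<B>(2)[OF that] sets.sets_into_space[of B \<Lambda>]
      by (metis Collect_conj_eq Collect_mem_eq Int_absorb1)
    note X = this
    have "{x \<in> space \<Lambda>. x \<in> B \<longleftrightarrow> B \<in> S} \<in> sets \<Lambda>" if "B \<in> \<B>" for B
      using X[OF that] sets.sets_Collect_neg[OF X[OF that]] by (cases "B \<in> S") auto
    then show ?thesis
      unfolding atom_def using X
      by (intro sets.sets_Collect_conj sets.sets_Collect_finite_Ex[OF _ \<B>(1)]
          sets.sets_Collect_finite_All[OF _ \<B>(1)])
  qed
  have D_sets: "D k \<in> sets \<Lambda>" for k using atom_sets C by (simp add: D_def)
  have disj_lt: "D i \<inter> D j = {}" if "i < n" "j < n" "i \<noteq> j" for i j
  proof -
    have "e i \<in> Pow \<B>" "e j \<in> Pow \<B>" using that unfolding im[symmetric] by simp_all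
    moreover have "e i \<noteq> e j" using inj_onD[OF inj, of i j] that by auto
    ultimately have "\<exists>B\<in>\<B>. B \<in> e i \<longleftrightarrow> B \<notin> e j" by blast
    then show ?thesis using that unfolding D_def atom_def by auto
  qed
  have disj_n: "D i \<inter> C = {}" if "i < n" for i
    using that C \<B>(2) unfolding D_def atom_def by fastforce
  have disj: "disjoint_family_on D {..n}"
    unfolding disjoint_family_on_def
  proof (intro ballI impI)
    fix i j assume "i \<in> {..n}" "j \<in> {..n}" "i \<noteq> j"
    then show "D i \<inter> D j = {}"
      using disj_lt[of i j] disj_n[of i] disj_n[of j] by (cases "i < n"; cases "j < n") (auto simp: D_def)
  qed
  \<comment> \<open>Each \<open>B\<close> is the disjoint union of the atoms whose label contains
    it, so its count is a sum of atom counts and every event about \<open>Q\<close> depends on these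
    alone.\<close>
  have count: "emeasure (N \<omega>) B = (\<Sum>k | k < n \<and> B \<in> e k. emeasure (N \<omega>) (D k))"
    if "B \<in> \<B>" "\<omega> \<in> space M" for B \<omega>
  proof -
    have BU: "B = (\<Union>k\<in>{k. k < n \<and> B \<in> e k}. D k)"
    proof (intro set_eqI iffI)
      fix x assume x: "x \<in> B"
      have "{B'\<in>\<B>. x \<in> B'} \<in> Pow \<B>" by auto
      then obtain k where k: "k < n" "e k = {B'\<in>\<B>. x \<in> B'}"
        unfolding im[symmetric] by auto
      have "x \<in> space \<Lambda>" using x \<B>(2)[OF that(1)] sets.sets_into_space by blast
      then have "x \<in> D k" using k x that by (auto simp: D_def atom_def)
      then show "x \<in> (\<Union>k\<in>{k. k < n \<and> B \<in> e k}. D k)" using k x that by auto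
    qed (use that in \<open>auto simp: D_def atom_def\<close>)
    have "disjoint_family_on D {k. k < n \<and> B \<in> e k}"
      by (rule disjoint_family_on_mono[OF _ disj]) auto
    from sum_emeasure[OF _ this, of "N \<omega>"] D_sets sets_count[OF that(2)]
    have "(\<Sum>k | k < n \<and> B \<in> e k. emeasure (N \<omega>) (D k)) =
        emeasure (N \<omega>) (\<Union>k\<in>{k. k < n \<and> B \<in> e k}. D k)"
      by auto
    then show ?thesis unfolding BU[symmetric] by (rule sym)
  qed
  \<comment> \<open>The indices below \<open>n\<close> carry the atoms and the index
    \<open>n\<close> carries \<open>C\<close>; independence is grouped into these two blocks, and
    \<open>W\<close> and \<open>V'\<close> are the two events written in their coordinates.\<close>
  have "indep_vars (\<lambda>_. borel) (\<lambda>i \<omega>. emeasure (N \<omega>) (D i)) {..n}"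
    using D_sets disj by (intro count_indep) auto
  then have ind: "indep_var (PiM {..<n} (\<lambda>_. borel)) (\<lambda>\<omega>. \<lambda>i\<in>{..<n}. emeasure (N \<omega>) (D i))
    (PiM {n} (\<lambda>_. borel)) (\<lambda>\<omega>. \<lambda>i\<in>{n}. emeasure (N \<omega>) (D i))"
    by (rule indep_var_restrict) (simp_all add: subset_iff)
  define W where "W = {v\<in>space (PiM {..<n} (\<lambda>_. borel :: ennreal measure)).
    \<forall>q\<in>Q. (\<Sum>k | k < n \<and> fst q \<in> e k. v k) \<in> snd q}"
  define V' where "V' = {v\<in>space (PiM {n} (\<lambda>_. borel :: ennreal measure)). v n \<in> V}"
  have "W \<in> sets (PiM {..<n} (\<lambda>_. borel))"
    unfolding W_def
  proof (rule sets.sets_Collect_finite_All[OF _ Q(1)])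
    fix q assume "q \<in> Q"
    then have [measurable]: "snd q \<in> sets borel" using Q(2)[of "fst q" "snd q"] by simp
    show "{v \<in> space (PiM {..<n} (\<lambda>_. borel :: ennreal measure)). (\<Sum>k | k < n \<and> fst q \<in> e k. v k) \<in> snd q}
       \<in> sets (PiM {..<n} (\<lambda>_. borel))"
    proof -
      have "(\<lambda>v. \<Sum>k | k < n \<and> fst q \<in> e k. v k) \<in> borel_measurable (PiM {..<n} (\<lambda>_. borel :: ennreal measure))"
        by (rule borel_measurable_sum) (auto intro!: measurable_component_singleton)
      from measurable_sets[OF this \<open>snd q \<in> sets borel\<close>] show ?thesis
        by (simp add: vimage_def Int_def conj_commute)
    qed
  qed
  moreover have "V' \<in> sets (PiM {n} (\<lambda>_. borel))"
    unfolding V'_def using V by measurable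
  ultimately have "prob ((\<lambda>\<omega>. (\<lambda>i\<in>{..<n}. emeasure (N \<omega>) (D i), \<lambda>i\<in>{n}. emeasure (N \<omega>) (D i))) -` (W \<times> V') \<inter> space M) =
     prob ((\<lambda>\<omega>. \<lambda>i\<in>{..<n}. emeasure (N \<omega>) (D i)) -` W \<inter> space M) *
     prob ((\<lambda>\<omega>. \<lambda>i\<in>{n}. emeasure (N \<omega>) (D i)) -` V' \<inter> space M)"
    by (rule indep_varD[OF ind])
  moreover have "(\<lambda>\<omega>. \<lambda>i\<in>{n}. emeasure (N \<omega>) (D i)) -` V' \<inter> space M = {\<omega>\<in>space M. emeasure (N \<omega>) C \<in> V}"
    by (auto simp: V'_def D_def space_PiM)
  moreover have "(\<lambda>\<omega>. \<lambda>i\<in>{..<n}. emeasure (N \<omega>) (D i)) -` W \<inter> space M =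
      {\<omega>\<in>space M. \<forall>(B, U)\<in>Q. emeasure (N \<omega>) B \<in> U}"
  proof -
    have "(\<lambda>i\<in>{..<n}. emeasure (N \<omega>) (D i)) \<in> W \<longleftrightarrow> (\<forall>(B, U)\<in>Q. emeasure (N \<omega>) B \<in> U)"
      if "\<omega> \<in> space M" for \<omega>
    proof -
      have "(\<Sum>k | k < n \<and> fst q \<in> e k. (\<lambda>i\<in>{..<n}. emeasure (N \<omega>) (D i)) k) = emeasure (N \<omega>) (fst q)"
        if "q \<in> Q" for q
        using that \<open>\<omega> \<in> space M\<close> by (subst count) (auto simp: \<B>_def intro!: sum.cong)
      then show ?thesis by (auto simp: W_def space_PiM split_beta)
    qed
    then show ?thesis by auto
  qed
  moreover have "(\<lambda>\<omega>. (\<lambda>i\<in>{..<n}. emeasure (N \<omega>) (D i), \<lambda>i\<in>{n}. emeasure (N \<omega>) (D i))) -` (W \<times> V') \<inter> space M =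
      ((\<lambda>\<omega>. \<lambda>i\<in>{..<n}. emeasure (N \<omega>) (D i)) -` W \<inter> space M) \<inter> ((\<lambda>\<omega>. \<lambda>i\<in>{n}. emeasure (N \<omega>) (D i)) -` V' \<inter> space M)"
    by auto
  ultimately show ?thesis by simp
qed

text \<open>Finite conjunctions of count events inside \<open>T\<close> form an intersection-stable
  generator of \<open>past T\<close>, on which the product rule is
  \<open>prob_past_event_mult\<close>. Independence extends to the generated sigma-algebras, and the
  function \<open>f\<close> lets it apply to the compensated count as well as to its square.\<close>

lemma indep_past_count:
  fixes Z :: "'w \<Rightarrow> real" and f :: "ennreal \<Rightarrow> real"
  assumes Z: "Z \<in> borel_measurable (past T)" and C: "C \<in> sets \<Lambda>" "C \<inter> T = {}"
    and f: "f \<in> borel_measurable borel"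
  shows "indep_var borel Z borel (\<lambda>\<omega>. f (emeasure (N \<omega>) C))"
proof -
  define \<A> where "\<A> = {{\<omega>\<in>space M. \<forall>(B, U)\<in>Q. emeasure (N \<omega>) B \<in> U} | Q. finite Q \<and>
    (\<forall>(B, U)\<in>Q. B \<in> sets \<Lambda> \<and> B \<subseteq> T \<and> U \<in> sets (borel :: ennreal measure))}"
  define \<C> where "\<C> = {{\<omega>\<in>space M. emeasure (N \<omega>) C \<in> V} | V. V \<in> sets (borel :: ennreal measure)}"
  have one: "{\<omega>\<in>space M. emeasure (N \<omega>) B \<in> U} = (\<lambda>\<omega>. emeasure (N \<omega>) B) -` U \<inter> space M" for B U
    by auto
  have one_M: "{\<omega>\<in>space M. emeasure (N \<omega>) B \<in> U} \<in> sets M" if "B \<in> sets \<Lambda>" "U \<in> sets borel" for B U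
    unfolding one using count_measurable[OF that(1)] that(2) by (rule measurable_sets)
  have A_M: "\<A> \<subseteq> sets M"
  proof
    fix E assume "E \<in> \<A>"
    then obtain Q where Q: "finite Q" "\<forall>(B, U)\<in>Q. B \<in> sets \<Lambda> \<and> B \<subseteq> T \<and> U \<in> sets borel"
      and E: "E = {\<omega>\<in>space M. \<forall>(B, U)\<in>Q. emeasure (N \<omega>) B \<in> U}" unfolding \<A>_def by blast
    show "E \<in> sets M"
      unfolding E using one_M Q(2)
      by (intro sets.sets_Collect_finite_All[OF _ Q(1)]) (auto simp: split_beta)
  qed
  have C_M: "\<C> \<subseteq> sets M" unfolding \<C>_def using one_M[OF C(1)] by blast
  have "indep_set \<A> \<C>"
  proof (rule indep_setI[OF A_M C_M])
    fix E F assume "E \<in> \<A>" "F \<in> \<C>"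
    then obtain Q V where Q: "finite Q" "\<forall>(B, U)\<in>Q. B \<in> sets \<Lambda> \<and> B \<subseteq> T \<and> U \<in> sets borel"
      and V: "V \<in> sets (borel :: ennreal measure)"
      and EF: "E = {\<omega>\<in>space M. \<forall>(B, U)\<in>Q. emeasure (N \<omega>) B \<in> U}" "F = {\<omega>\<in>space M. emeasure (N \<omega>) C \<in> V}"
      unfolding \<A>_def \<C>_def by blast
    show "prob (E \<inter> F) = prob E * prob F"
      unfolding EF using prob_past_event_mult[OF Q(1) _ C V] Q(2) by blast
  qed
  moreover have "Int_stable \<A>"
  proof (rule Int_stableI)
    fix E F assume "E \<in> \<A>" "F \<in> \<A>"
    then obtain Q R where Q: "finite Q" "\<forall>(B, U)\<in>Q. B \<in> sets \<Lambda> \<and> B \<subseteq> T \<and> U \<in> sets borel"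
      and R: "finite R" "\<forall>(B, U)\<in>R. B \<in> sets \<Lambda> \<and> B \<subseteq> T \<and> U \<in> sets borel"
      and EF: "E = {\<omega>\<in>space M. \<forall>(B, U)\<in>Q. emeasure (N \<omega>) B \<in> U}"
        "F = {\<omega>\<in>space M. \<forall>(B, U)\<in>R. emeasure (N \<omega>) B \<in> U}"
      unfolding \<A>_def by blast
    have "E \<inter> F = {\<omega>\<in>space M. \<forall>(B, U)\<in>Q \<union> R. emeasure (N \<omega>) B \<in> U}"
      unfolding EF by blast
    moreover have "finite (Q \<union> R)" "\<forall>(B, U)\<in>Q \<union> R. B \<in> sets \<Lambda> \<and> B \<subseteq> T \<and> U \<in> sets borel"
      using Q R by blast+
    ultimately show "E \<inter> F \<in> \<A>" unfolding \<A>_def by blast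
  qed
  moreover have "Int_stable \<C>"
  proof (rule Int_stableI)
    fix E F assume "E \<in> \<C>" "F \<in> \<C>"
    then obtain U V where "U \<in> sets (borel :: ennreal measure)" "V \<in> sets (borel :: ennreal measure)"
      and "E = {\<omega>\<in>space M. emeasure (N \<omega>) C \<in> U}" "F = {\<omega>\<in>space M. emeasure (N \<omega>) C \<in> V}"
      unfolding \<C>_def by blast
    then have "E \<inter> F = {\<omega>\<in>space M. emeasure (N \<omega>) C \<in> U \<inter> V}" "U \<inter> V \<in> sets borel" by auto
    then show "E \<inter> F \<in> \<C>" unfolding \<C>_def by blast
  qed
  ultimately have ind: "indep_set (sigma_sets (space M) \<A>) (sigma_sets (space M) \<C>)"
    by (rule indep_set_sigma_sets)
  have past_sub: "sets (past T) \<subseteq> sigma_sets (space M) \<A>"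
    unfolding sets_past
  proof (rule sigma_sets_mono', safe)
    fix B and U :: "ennreal set" assume BU: "B \<in> sets \<Lambda>" "B \<subseteq> T" "U \<in> sets borel"
    have "(\<lambda>\<omega>. emeasure (N \<omega>) B) -` U \<inter> space M = {\<omega>\<in>space M. \<forall>(B, U)\<in>{(B, U)}. emeasure (N \<omega>) B \<in> U}"
      by auto
    then show "(\<lambda>\<omega>. emeasure (N \<omega>) B) -` U \<inter> space M \<in> \<A>"
      unfolding \<A>_def using BU by (intro CollectI exI[of _ "{(B, U)}"] conjI) simp_all
  qed
  have "sigma_sets (space M) {Z -` A \<inter> space M | A. A \<in> sets borel} \<subseteq> sigma_sets (space M) \<A>"
  proof (rule sigma_sets_mono, safe)
    fix A :: "real set" assume "A \<in> sets borel"
    from measurable_sets[OF Z this] show "Z -` A \<inter> space M \<in> sigma_sets (space M) \<A>"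
      using past_sub by auto
  qed
  moreover have "sigma_sets (space M) {(\<lambda>\<omega>. f (emeasure (N \<omega>) C)) -` A \<inter> space M | A. A \<in> sets borel}
      \<subseteq> sigma_sets (space M) \<C>"
  proof (rule sigma_sets_mono', safe)
    fix A :: "real set" assume "A \<in> sets borel"
    with f have "f -` A \<in> sets borel" by (simp add: measurable_sets_borel)
    moreover have "(\<lambda>\<omega>. f (emeasure (N \<omega>) C)) -` A \<inter> space M = {\<omega>\<in>space M. emeasure (N \<omega>) C \<in> f -` A}"
      by auto
    ultimately show "(\<lambda>\<omega>. f (emeasure (N \<omega>) C)) -` A \<inter> space M \<in> \<C>"
      unfolding \<C>_def by blast
  qed
  moreover have "Z \<in> borel_measurable M" "(\<lambda>\<omega>. f (emeasure (N \<omega>) C)) \<in> borel_measurable M"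
    using past_measurable[OF Z] measurable_compose[OF count_measurable[OF C(1)] f] by auto
  ultimately show ?thesis
    using ind unfolding indep_var_eq indep_set_def
    by (intro conjI indep_sets_mono_sets[OF ind[unfolded indep_set_def]]) (auto split: bool.split)
qed

section \<open>Product moments of compensated counts with a weight known from the past\<close>

lemma indep_past_compensated:
  assumes Z: "Z \<in> borel_measurable (past T)" and C: "C \<in> sets \<Lambda>" "C \<inter> T = {}"
  shows "indep_var borel Z borel (compensated \<Lambda> N C)"
    and "indep_var borel Z borel (\<lambda>\<omega>. (compensated \<Lambda> N C \<omega>)\<^sup>2)"
  using indep_past_count[OF assms, of "\<lambda>x. enn2real x - measure \<Lambda> C"]
    indep_past_count[OF assms, of "\<lambda>x. (enn2real x - measure \<Lambda> C)\<^sup>2"]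
  by (simp_all add: compensated_def[abs_def] measure_def[of "N _"])

text \<open>Independence factorizes both expectations. The first is the martingale property of the
  compensated noise, the second its conditional variance.\<close>

lemma integral_past_compensated:
  assumes Z: "Z \<in> borel_measurable (past T)" "integrable M Z"
    and C: "C \<in> sets \<Lambda>" "emeasure \<Lambda> C < \<infinity>" "C \<inter> T = {}"
  shows "has_bochner_integral M (\<lambda>\<omega>. Z \<omega> * compensated \<Lambda> N C \<omega>) 0"
    and "has_bochner_integral M (\<lambda>\<omega>. Z \<omega> * (compensated \<Lambda> N C \<omega>)\<^sup>2) (expectation Z * measure \<Lambda> C)"
  using indep_past_compensated[OF Z(1) C(1,3)] compensated_moments[OF C(1,2)] Z(2)
    indep_var_lebesgue_integral[of Z "compensated \<Lambda> N C"]
    indep_var_lebesgue_integral[of Z "\<lambda>\<omega>. (compensated \<Lambda> N C \<omega>)\<^sup>2"]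
    indep_var_integrable[of Z "compensated \<Lambda> N C"]
    indep_var_integrable[of Z "\<lambda>\<omega>. (compensated \<Lambda> N C \<omega>)\<^sup>2"]
  by (simp_all add: has_bochner_integral_iff)

lemma integral_past_compensated_disjoint:
  assumes Z: "Z \<in> borel_measurable (past T)" "integrable M Z"
    and A: "A \<in> sets \<Lambda>" "emeasure \<Lambda> A < \<infinity>" "A \<inter> T = {}"
    and B: "B \<in> sets \<Lambda>" "emeasure \<Lambda> B < \<infinity>" "B \<inter> T = {}"
    and AB: "A \<inter> B = {}"
  shows "has_bochner_integral M (\<lambda>\<omega>. Z \<omega> * (compensated \<Lambda> N A \<omega> * compensated \<Lambda> N B \<omega>)) 0"
proof -
  let ?X = "compensated \<Lambda> N"
  have U: "A \<union> B \<in> sets \<Lambda>" "emeasure \<Lambda> (A \<union> B) < \<infinity>" "(A \<union> B) \<inter> T = {}"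
    using A B AB by (auto simp: plus_emeasure[symmetric])
  (* polarization *)
  have "measure \<Lambda> (A \<union> B) = measure \<Lambda> A + measure \<Lambda> B"
    using A B AB by (intro measure_Union) auto
  then have "has_bochner_integral M (\<lambda>\<omega>. (Z \<omega> * (?X (A \<union> B) \<omega>)\<^sup>2 - Z \<omega> * (?X A \<omega>)\<^sup>2 - Z \<omega> * (?X B \<omega>)\<^sup>2) / 2) 0"
    using has_bochner_integral_divide_zero[OF has_bochner_integral_diff[OF has_bochner_integral_diff[OF
       integral_past_compensated(2)[OF Z U] integral_past_compensated(2)[OF Z A]] integral_past_compensated(2)[OF Z B]], of 2]
    by (simp add: algebra_simps)
  moreover have "AE \<omega> in M. (Z \<omega> * (?X (A \<union> B) \<omega>)\<^sup>2 - Z \<omega> * (?X A \<omega>)\<^sup>2 - Z \<omega> * (?X B \<omega>)\<^sup>2) / 2 = Z \<omega> * (?X A \<omega> * ?X B \<omega>)"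
    using AE_compensated_Un[OF A(1,2) B(1,2) AB]
    by eventually_elim (simp add: power2_eq_square algebra_simps)
  moreover have "(\<lambda>\<omega>. Z \<omega> * (?X A \<omega> * ?X B \<omega>)) \<in> borel_measurable M"
    using past_measurable[OF Z(1)] compensated_measurable A(1) B(1) by (intro borel_measurable_times) auto
  ultimately show ?thesis
    by (subst has_bochner_integral_cong_AE[symmetric]) (auto intro: borel_measurable_has_bochner_integral)
qed

text \<open>Both sets are split along their intersection \<open>D\<close>. Of the four resulting
  products only the square over \<open>D\<close> has a nonzero mean, the others pairing disjoint
  sets.\<close>

lemma integral_past_compensated_mult:
  assumes Z: "Z \<in> borel_measurable (past T)" "integrable M Z"
    and A: "A \<in> sets \<Lambda>" "emeasure \<Lambda> A < \<infinity>" "A \<inter> T = {}"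
    and B: "B \<in> sets \<Lambda>" "emeasure \<Lambda> B < \<infinity>" "B \<inter> T = {}"
  shows "has_bochner_integral M (\<lambda>\<omega>. Z \<omega> * (compensated \<Lambda> N A \<omega> * compensated \<Lambda> N B \<omega>))
    (expectation Z * measure \<Lambda> (A \<inter> B))"
proof -
  let ?X = "compensated \<Lambda> N"
  define D where "D = A \<inter> B"
  have fin: "emeasure \<Lambda> E < \<infinity>" if "E \<subseteq> A \<or> E \<subseteq> B" for E
    using that emeasure_mono[of E A \<Lambda>] emeasure_mono[of E B \<Lambda>] A B by (auto intro: le_less_trans)
  have D: "D \<in> sets \<Lambda>" "emeasure \<Lambda> D < \<infinity>" "D \<inter> T = {}"
    and A': "A - D \<in> sets \<Lambda>" "emeasure \<Lambda> (A - D) < \<infinity>" "(A - D) \<inter> T = {}"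
    and B': "B - D \<in> sets \<Lambda>" "emeasure \<Lambda> (B - D) < \<infinity>" "(B - D) \<inter> T = {}"
    using A B fin[of D] fin[of "A - D"] fin[of "B - D"] by (auto simp: D_def)
  have disj: "D \<inter> (A - D) = {}" "D \<inter> (B - D) = {}" "(A - D) \<inter> (B - D) = {}"
    by (auto simp: D_def)
  have un: "D \<union> (A - D) = A" "D \<union> (B - D) = B" by (auto simp: D_def)
  note h = integral_past_compensated_disjoint[OF Z]
  have "has_bochner_integral M (\<lambda>\<omega>. Z \<omega> * (?X D \<omega>)\<^sup>2 + Z \<omega> * (?X D \<omega> * ?X (A - D) \<omega>) +
      Z \<omega> * (?X D \<omega> * ?X (B - D) \<omega>) + Z \<omega> * (?X (A - D) \<omega> * ?X (B - D) \<omega>))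
      (expectation Z * measure \<Lambda> D + 0 + 0 + 0)"
    by (intro has_bochner_integral_add integral_past_compensated(2)[OF Z D]
        h[OF D A' disj(1)] h[OF D B' disj(2)] h[OF A' B' disj(3)])
  moreover have "AE \<omega> in M. Z \<omega> * (?X D \<omega>)\<^sup>2 + Z \<omega> * (?X D \<omega> * ?X (A - D) \<omega>) +
      Z \<omega> * (?X D \<omega> * ?X (B - D) \<omega>) + Z \<omega> * (?X (A - D) \<omega> * ?X (B - D) \<omega>) = Z \<omega> * (?X A \<omega> * ?X B \<omega>)"
    using AE_compensated_Un[OF D(1,2) A'(1,2) disj(1)] AE_compensated_Un[OF D(1,2) B'(1,2) disj(2)]
    unfolding un by eventually_elim (simp add: power2_eq_square algebra_simps)
  moreover have "(\<lambda>\<omega>. Z \<omega> * (?X A \<omega> * ?X B \<omega>)) \<in> borel_measurable M"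
    using past_measurable[OF Z(1)] compensated_measurable A(1) B(1) by (intro borel_measurable_times) auto
  ultimately show ?thesis
    unfolding D_def[symmetric]
    by (subst has_bochner_integral_cong_AE[symmetric]) (auto intro: borel_measurable_has_bochner_integral)
qed

text \<open>Two elementary processes may start at different times, so the earlier box
  \<open>A\<close> can reach into the past \<open>T\<close> of the later one. Over
  \<open>A \<inter> T\<close> the compensated count joins \<open>Z\<close> as a past weight and the
  product has mean zero; over \<open>A - T\<close> both sets avoid \<open>T\<close>, and the
  intersection with \<open>B\<close> is unchanged.\<close>

lemma integral_elementary_mult:
  assumes Z: "Z \<in> borel_measurable (past T)" "bounded (Z ` space M)" and T: "T \<in> sets \<Lambda>"
    and A: "A \<in> sets \<Lambda>" "emeasure \<Lambda> A < \<infinity>"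
    and B: "B \<in> sets \<Lambda>" "emeasure \<Lambda> B < \<infinity>" "B \<inter> T = {}"
  shows "has_bochner_integral M (\<lambda>\<omega>. Z \<omega> * (compensated \<Lambda> N A \<omega> * compensated \<Lambda> N B \<omega>))
    (expectation Z * measure \<Lambda> (A \<inter> B))"
proof -
  let ?X = "compensated \<Lambda> N"
  have ZM[measurable]: "Z \<in> borel_measurable M" by (rule past_measurable[OF Z(1)])
  obtain K where K: "\<And>\<omega>. \<omega> \<in> space M \<Longrightarrow> \<bar>Z \<omega>\<bar> \<le> K"
    using Z(2) by (auto simp: bounded_iff)
  have Zi: "integrable M Z"
    using K by (intro integrable_const_bound[of _ K]) auto
  have P: "A \<inter> T \<in> sets \<Lambda>" "emeasure \<Lambda> (A \<inter> T) < \<infinity>"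
    and R: "A - T \<in> sets \<Lambda>" "emeasure \<Lambda> (A - T) < \<infinity>" "(A - T) \<inter> T = {}"
    using A T emeasure_mono[of "A \<inter> T" A \<Lambda>] emeasure_mono[of "A - T" A \<Lambda>]
    by (auto intro: le_less_trans)
  have "(\<lambda>\<omega>. Z \<omega> * ?X (A \<inter> T) \<omega>) \<in> borel_measurable (past T)"
    unfolding compensated_def[abs_def] measure_def[of "N _"]
    by (intro borel_measurable_times borel_measurable_diff Z borel_measurable_const
        measurable_compose[OF count_past_measurable[OF P(1)]]) auto
  moreover have "integrable M (\<lambda>\<omega>. Z \<omega> * ?X (A \<inter> T) \<omega>)"
  proof (rule Bochner_Integration.integrable_bound[where f = "\<lambda>\<omega>. K * ?X (A \<inter> T) \<omega>"])
    show "integrable M (\<lambda>\<omega>. K * ?X (A \<inter> T) \<omega>)"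
      using compensated_moments(1)[OF P] by (auto simp: has_bochner_integral_iff)
    show "AE \<omega> in M. norm (Z \<omega> * ?X (A \<inter> T) \<omega>) \<le> norm (K * ?X (A \<inter> T) \<omega>)"
      using order_trans[OF K abs_ge_self] by (auto simp: abs_mult intro!: AE_I2 mult_right_mono)
  qed (use compensated_measurable[OF P(1)] in measurable)
  ultimately have "has_bochner_integral M (\<lambda>\<omega>. Z \<omega> * ?X (A \<inter> T) \<omega> * ?X B \<omega> + Z \<omega> * (?X (A - T) \<omega> * ?X B \<omega>))
      (0 + expectation Z * measure \<Lambda> ((A - T) \<inter> B))"
    by (intro has_bochner_integral_add integral_past_compensated(1)[OF _ _ B]
        integral_past_compensated_mult[OF Z(1) Zi R B])
  moreover have "(A - T) \<inter> B = A \<inter> B" using B by auto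
  moreover have "AE \<omega> in M. Z \<omega> * ?X (A \<inter> T) \<omega> * ?X B \<omega> + Z \<omega> * (?X (A - T) \<omega> * ?X B \<omega>) = Z \<omega> * (?X A \<omega> * ?X B \<omega>)"
  proof -
    have "A \<inter> T \<union> (A - T) = A" "A \<inter> T \<inter> (A - T) = {}" by auto
    from AE_compensated_Un[OF P R(1,2) this(2)] this(1) show ?thesis
      by (auto simp: algebra_simps elim!: eventually_mono)
  qed
  moreover have "(\<lambda>\<omega>. Z \<omega> * (?X A \<omega> * ?X B \<omega>)) \<in> borel_measurable M"
    using ZM compensated_measurable A(1) B(1) by (intro borel_measurable_times) auto
  ultimately show ?thesis
    by (subst has_bochner_integral_cong_AE[symmetric]) (auto intro: borel_measurable_has_bochner_integral)
qed

end

section \<open>The isometry of the compensated integral\<close>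

text \<open>The generators of the predictable sigma-algebra are measurable rectangles, so it is
  coarser than the product sigma-algebra; predictable fields are therefore jointly measurable, as
  Tonelli demands.\<close>

lemma predictable_sigma_measurable_ident:
  assumes "\<And>t. 0 \<le> t \<Longrightarrow> sets (F t) \<subseteq> sets M"
  shows "(\<lambda>x. x) \<in> measurable (restrict_space borel {0<..} \<Otimes>\<^sub>M M) (predictable_sigma M F)"
  unfolding predictable_sigma_def
proof (rule measurable_measure_of)
  show "{{a<..b} \<times> A |a b A. 0 \<le> a \<and> a < b \<and> A \<in> sets (F a)} \<subseteq> Pow ({0<..} \<times> space M)"
    using assms sets.sets_into_space[of _ M] by fastforce
  show "(\<lambda>x. x) \<in> space (restrict_space borel {0<..} \<Otimes>\<^sub>M M) \<rightarrow> {0<..} \<times> space M"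
    by (auto simp: space_pair_measure space_restrict_space)
next
  fix E assume "E \<in> {{a<..b} \<times> A |a b A. 0 \<le> a \<and> a < b \<and> A \<in> sets (F a)}"
  then obtain a b A where E: "E = {a<..b} \<times> A" "0 \<le> a" "A \<in> sets M"
    using assms by blast
  have "E \<in> sets (restrict_space borel {0<..} \<Otimes>\<^sub>M M)"
    unfolding E using E(2,3) by (intro pair_measureI) (auto simp: sets_restrict_space_iff)
  from sets.Int[OF this sets.top] show "(\<lambda>x. x) -` E \<inter> space (restrict_space borel {0<..} \<Otimes>\<^sub>M M)
      \<in> sets (restrict_space borel {0<..} \<Otimes>\<^sub>M M)"
    by (simp only: vimage_ident)
qed

lemma predictable_field_measurable:
  assumes X: "predictable_field M F X" and F: "\<And>t. 0 \<le> t \<Longrightarrow> sets (F t) \<subseteq> sets M"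
  shows "(\<lambda>((t, \<omega>), z). X t z \<omega>) \<in> borel_measurable ((restrict_space borel {0<..} \<Otimes>\<^sub>M M) \<Otimes>\<^sub>M borel)"
proof -
  have "(\<lambda>(p, z). (p, z)) \<in> measurable ((restrict_space borel {0<..} \<Otimes>\<^sub>M M) \<Otimes>\<^sub>M borel)
      (predictable_sigma M F \<Otimes>\<^sub>M borel)"
    unfolding split_beta
    by (intro measurable_Pair measurable_snd
        measurable_compose[OF measurable_fst predictable_sigma_measurable_ident[OF F]])
  from measurable_compose[OF this X[unfolded predictable_field_def]] show ?thesis
    by (simp add: case_prod_unfold)
qed

lemma predictable_field_section_measurable:
  assumes "predictable_field M F X" "\<And>t. 0 \<le> t \<Longrightarrow> sets (F t) \<subseteq> sets M" and t: "0 < t"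
  shows "X t z \<in> borel_measurable M"
proof -
  have "(\<lambda>\<omega>. ((t, \<omega>), z)) \<in> measurable M ((restrict_space borel {0<..} \<Otimes>\<^sub>M M) \<Otimes>\<^sub>M borel)"
    using t by (intro measurable_Pair measurable_const measurable_ident) (auto simp: space_restrict_space)
  from measurable_compose[OF this predictable_field_measurable[OF assms(1,2)]] show ?thesis
    by simp
qed

text \<open>The sets where \<open>of_nat n * f x\<close> is at least 1 have finite measure by
  Markov's inequality, and they exhaust the space because \<open>f\<close> is positive.\<close>

lemma sigma_finite_positive_integrable:
  assumes [measurable]: "f \<in> borel_measurable M" and pos: "\<And>x. (0::ennreal) < f x"
    and fin: "(\<integral>\<^sup>+x. f x \<partial>M) < \<infinity>"
  shows "sigma_finite_measure M"
proof
  let ?A = "\<lambda>n::nat. {x\<in>space M. 1 \<le> of_nat n * f x}"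
  have "emeasure M (?A n) \<noteq> \<infinity>" for n
  proof -
    have "emeasure M (?A n) \<le> of_nat n * (\<integral>\<^sup>+x. f x * indicator (space M) x \<partial>M)"
      by (rule nn_integral_Markov_inequality) auto
    also have "(\<integral>\<^sup>+x. f x * indicator (space M) x \<partial>M) = (\<integral>\<^sup>+x. f x \<partial>M)"
      by (rule nn_integral_cong) simp
    also have "of_nat n * \<dots> < \<infinity>" using fin by (simp add: ennreal_mult_less_top of_nat_less_top)
    finally show ?thesis by simp
  qed
  moreover have "(\<Union>n. ?A n) = space M"
  proof -
    have "\<exists>n::nat. 1 \<le> of_nat n * f x" for x
    proof (cases "f x = \<infinity>")
      case True
      then show ?thesis by (intro exI[of _ 1]) simp
    next
      case False
      then obtain r where r: "f x = ennreal r" "0 < r" using pos[of x] by (cases "f x") auto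
      obtain n :: nat where "1 / r < n" using reals_Archimedean2 by blast
      then have "1 \<le> real n * r" using r by (simp add: field_simps)
      then have "ennreal 1 \<le> ennreal (real n * r)" by (rule ennreal_leI)
      then show ?thesis using r by (auto simp: ennreal_mult' ennreal_of_nat_eq_real_of_nat)
    qed
    then show ?thesis by auto
  qed
  ultimately show "\<exists>A. countable A \<and> A \<subseteq> sets M \<and> \<Union>A = space M \<and> (\<forall>a\<in>A. emeasure M a \<noteq> \<infinity>)"
    by (intro exI[of _ "range ?A"]) auto
qed

lemma (in pair_sigma_finite) has_bochner_integral_indicator_mult:
  fixes g :: "_ \<Rightarrow> real"
  assumes B: "B \<in> sets M1" "emeasure M1 B < \<infinity>" and g: "integrable M2 g"
  shows "has_bochner_integral (M1 \<Otimes>\<^sub>M M2) (\<lambda>(z, \<omega>). indicator B z * g \<omega>) (measure M1 B * integral\<^sup>L M2 g)"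
proof -
  note [measurable] = B(1) borel_measurable_integrable[OF g]
  let ?f = "\<lambda>(z, \<omega>). indicator B z * g \<omega>"
  have int: "integrable (M1 \<Otimes>\<^sub>M M2) ?f"
  proof (rule Fubini_integrable)
    have "integrable M1 (\<lambda>x. indicator B x * (LINT y|M2. \<bar>g y\<bar>))"
      using B by (intro integrable_mult_left integrable_real_indicator) auto
    then show "integrable M1 (\<lambda>x. LINT y|M2. norm (?f (x, y)))"
      by (simp add: abs_mult)
  qed (use g in auto)
  moreover have "integral\<^sup>L (M1 \<Otimes>\<^sub>M M2) ?f = measure M1 B * integral\<^sup>L M2 g"
    using integral_fst'[OF int] B by simp
  ultimately show ?thesis by (simp add: has_bochner_integral_iff)
qed

text \<open>A weighted Young inequality that plays the role of the triangle inequality in L2. It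
  avoids square roots of extended reals, at the price of a factor 1 + e that is removed by letting e
  tend to 0.\<close>

lemma nn_integral_square_le:
  fixes f g :: "'b \<Rightarrow> real"
  assumes [measurable]: "f \<in> borel_measurable M" "g \<in> borel_measurable M" and e: "0 < e"
  shows "(\<integral>\<^sup>+x. ennreal ((f x)\<^sup>2) \<partial>M) \<le> ennreal (1 + e) * (\<integral>\<^sup>+x. ennreal ((g x)\<^sup>2) \<partial>M) +
    ennreal (1 + 1 / e) * (\<integral>\<^sup>+x. ennreal ((g x - f x)\<^sup>2) \<partial>M)"
proof -
  have pt: "(f x)\<^sup>2 \<le> (1 + e) * (g x)\<^sup>2 + (1 + 1 / e) * (g x - f x)\<^sup>2" for x
  proof -
    \<comment> \<open>With d = g - f the difference is e g^2 + 2 g d + d^2 / e, a complete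
      square.\<close>
    have "(1 + e) * (g x)\<^sup>2 + (1 + 1 / e) * (g x - f x)\<^sup>2 - (f x)\<^sup>2 = (e * g x + (g x - f x))\<^sup>2 / e"
      using e by (simp add: power2_eq_square field_simps)
    moreover have "0 \<le> (e * g x + (g x - f x))\<^sup>2 / e" using e by simp
    ultimately show ?thesis by linarith
  qed
  have "(\<integral>\<^sup>+x. ennreal ((f x)\<^sup>2) \<partial>M) \<le>
      (\<integral>\<^sup>+x. ennreal (1 + e) * ennreal ((g x)\<^sup>2) + ennreal (1 + 1 / e) * ennreal ((g x - f x)\<^sup>2) \<partial>M)"
    using pt e by (intro nn_integral_mono) (simp add: ennreal_leI flip: ennreal_mult ennreal_plus)
  also have "\<dots> = ennreal (1 + e) * (\<integral>\<^sup>+x. ennreal ((g x)\<^sup>2) \<partial>M) +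
      ennreal (1 + 1 / e) * (\<integral>\<^sup>+x. ennreal ((g x - f x)\<^sup>2) \<partial>M)"
    by (simp add: nn_integral_add nn_integral_cmult)
  finally show ?thesis .
qed

locale levy_noise = prob_space M for M :: "'w measure" +
  fixes \<mu> :: "'a::euclidean_space measure" and N :: "'w \<Rightarrow> (real \<times> 'a \<times> 'a) measure"
  assumes noise: "poisson_random_measure M (noise_intensity \<mu>) N"
    and sets_\<mu>[measurable_cong]: "sets \<mu> = sets borel"
    and sigma_finite_\<mu>: "sigma_finite_measure \<mu>"

sublocale levy_noise \<subseteq> poisson_noise M "noise_intensity \<mu>" N
  by unfold_locales (rule noise)

sublocale levy_noise \<subseteq> mu: sigma_finite_measure \<mu>
  by (rule sigma_finite_\<mu>)

context levy_noise begin

lemma noise_filtration_eq_past: "noise_filtration M \<mu> N t = past ({0..t} \<times> UNIV)"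
  by (simp add: noise_filtration_def past_def)

lemma noise_filtration_subset: "sets (noise_filtration M \<mu> N t) \<subseteq> sets M"
  unfolding noise_filtration_eq_past by (rule sets_past_subset)

lemma space_\<mu>: "space \<mu> = UNIV"
  using sets_eq_imp_space_eq[OF sets_\<mu>] by simp

lemma sets_intensity[measurable_cong]:
  "sets (noise_intensity \<mu>) = sets (restrict_space borel {0..} \<Otimes>\<^sub>M (borel \<Otimes>\<^sub>M borel))"
  unfolding noise_intensity_def
  by (intro sets_pair_measure_cong sets_\<mu> sets_lborel sets_restrict_space_cong)

lemma sigma_finite_space_part: "sigma_finite_measure (lborel \<Otimes>\<^sub>M \<mu>)"
  by (rule sigma_finite_pair_measure[OF sigma_finite_lborel sigma_finite_\<mu>])

lemma sigma_finite_intensity: "sigma_finite_measure (noise_intensity \<mu>)"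
  unfolding noise_intensity_def
  by (intro sigma_finite_pair_measure sigma_finite_measure_restrict_space
      sigma_finite_lborel sigma_finite_\<mu>) simp

lemma pair_sigma_finite_intensity: "pair_sigma_finite (noise_intensity \<mu>) M"
  by (intro pair_sigma_finite.intro sigma_finite_intensity sigma_finite_measure)

(* The intensity lives on closed half-lines [0,oo), integrands only on (0,oo). *)
definition time_ext :: "(real \<Rightarrow> 'a \<times> 'a \<Rightarrow> 'w \<Rightarrow> real) \<Rightarrow> (real \<times> 'a \<times> 'a) \<times> 'w \<Rightarrow> real" where
  "time_ext X = (\<lambda>((s, z), \<omega>). indicator {0<..} s * X s z \<omega>)"

text \<open>Joint measurability is known at positive times only, and with the coordinates in another
  order. It is transferred to the measurable set \<open>A\<close> of positive times and extended by
  zero.\<close>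

lemma time_ext_measurable:
  assumes X: "predictable_field M (noise_filtration M \<mu> N) X"
  shows "time_ext X \<in> borel_measurable (noise_intensity \<mu> \<Otimes>\<^sub>M M)"
proof -
  let ?P = "noise_intensity \<mu> \<Otimes>\<^sub>M M"
  define A where "A = {p \<in> space ?P. fst (fst p) \<in> {0<..}}"
  have [measurable]: "(\<lambda>p. fst (fst p)) \<in> borel_measurable ?P"
  proof -
    have "(\<lambda>p. fst (fst p)) \<in> measurable ?P (restrict_space borel {0..})"
      using sets_intensity by (intro measurable_compose[OF measurable_fst]) measurable
    then show ?thesis by (simp add: measurable_restrict_space2_iff)
  qed
  have A: "A \<in> sets ?P" unfolding A_def by measurable
  have "(\<lambda>p. ((fst (fst p), snd p), snd (fst p))) \<in> measurable (restrict_space ?P A)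
      ((restrict_space borel {0<..} \<Otimes>\<^sub>M M) \<Otimes>\<^sub>M borel)"
  proof (intro measurable_Pair)
    show "(\<lambda>p. fst (fst p)) \<in> measurable (restrict_space ?P A) (restrict_space borel {0<..})"
      by (intro measurable_restrict_space2 measurable_restrict_space1) (auto simp: A_def space_restrict_space)
    show "snd \<in> measurable (restrict_space ?P A) M"
      by (intro measurable_restrict_space1 measurable_snd)
    have "(\<lambda>p. snd (fst p)) \<in> measurable ?P (borel \<Otimes>\<^sub>M borel)"
      using sets_intensity by (intro measurable_compose[OF measurable_fst]) measurable
    then show "(\<lambda>p. snd (fst p)) \<in> borel_measurable (restrict_space ?P A)"
      unfolding borel_prod by (rule measurable_restrict_space1)
  qed
  from measurable_compose[OF this predictable_field_measurable[OF X noise_filtration_subset]]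
  have "(\<lambda>p. X (fst (fst p)) (snd (fst p)) (snd p)) \<in> borel_measurable (restrict_space ?P A)"
    by simp
  then have "(\<lambda>p. indicator A p *\<^sub>R X (fst (fst p)) (snd (fst p)) (snd p)) \<in> borel_measurable ?P"
    using A by (subst borel_measurable_restrict_space_iff[symmetric]) auto
  moreover have "indicator A p *\<^sub>R X (fst (fst p)) (snd (fst p)) (snd p) = time_ext X p"
    if "p \<in> space ?P" for p
    using that by (auto simp: time_ext_def A_def split: prod.splits split_indicator)
  ultimately show ?thesis by (simp cong: measurable_cong)
qed

text \<open>Tonelli turns the iterated integral into a squared L2 norm over a single product space,
  the form in which approximations can be compared.\<close>

lemma integrand_sqnorm_eq:
  assumes [measurable]: "time_ext X \<in> borel_measurable (noise_intensity \<mu> \<Otimes>\<^sub>M M)"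
  shows "integrand_sqnorm M \<mu> X = (\<integral>\<^sup>+p. ennreal ((time_ext X p)\<^sup>2) \<partial>(noise_intensity \<mu> \<Otimes>\<^sub>M M))"
proof -
  interpret S: sigma_finite_measure "lborel \<Otimes>\<^sub>M \<mu>" by (rule sigma_finite_space_part)
  let ?f = "\<lambda>s y h \<omega>. ennreal ((time_ext X ((s, y, h), \<omega>))\<^sup>2)"
  have m1: "(\<lambda>z. \<integral>\<^sup>+\<omega>. ennreal ((time_ext X (z, \<omega>))\<^sup>2) \<partial>M) \<in> borel_measurable (noise_intensity \<mu>)"
    by measurable
  have "(\<integral>\<^sup>+p. ennreal ((time_ext X p)\<^sup>2) \<partial>(noise_intensity \<mu> \<Otimes>\<^sub>M M)) =
      (\<integral>\<^sup>+z. \<integral>\<^sup>+\<omega>. ennreal ((time_ext X (z, \<omega>))\<^sup>2) \<partial>M \<partial>noise_intensity \<mu>)"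
    by (subst nn_integral_fst) simp_all
  also have "\<dots> = (\<integral>\<^sup>+s. \<integral>\<^sup>+w. \<integral>\<^sup>+\<omega>. ennreal ((time_ext X ((s, w), \<omega>))\<^sup>2) \<partial>M \<partial>(lborel \<Otimes>\<^sub>M \<mu>)
      \<partial>restrict_space lborel {0..})"
    using m1 unfolding noise_intensity_def by (subst S.nn_integral_fst) simp_all
  also have "\<dots> = (\<integral>\<^sup>+s. \<integral>\<^sup>+y. \<integral>\<^sup>+h. \<integral>\<^sup>+\<omega>. ?f s y h \<omega> \<partial>M \<partial>\<mu> \<partial>lborel \<partial>restrict_space lborel {0..})"
  proof (rule nn_integral_cong)
    fix s :: real assume s: "s \<in> space (restrict_space lborel {0..})"
    have "(\<lambda>w. \<integral>\<^sup>+\<omega>. ennreal ((time_ext X ((s, w), \<omega>))\<^sup>2) \<partial>M) \<in> borel_measurable (lborel \<Otimes>\<^sub>M \<mu>)"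
      using measurable_compose[OF measurable_Pair1'[OF s] m1[unfolded noise_intensity_def]] by simp
    then show "(\<integral>\<^sup>+w. \<integral>\<^sup>+\<omega>. ennreal ((time_ext X ((s, w), \<omega>))\<^sup>2) \<partial>M \<partial>(lborel \<Otimes>\<^sub>M \<mu>)) =
       (\<integral>\<^sup>+y. \<integral>\<^sup>+h. \<integral>\<^sup>+\<omega>. ?f s y h \<omega> \<partial>M \<partial>\<mu> \<partial>lborel)"
      by (subst mu.nn_integral_fst) simp_all
  qed
  also have "\<dots> = (\<integral>\<^sup>+s. (\<integral>\<^sup>+y. \<integral>\<^sup>+h. \<integral>\<^sup>+\<omega>. ?f s y h \<omega> \<partial>M \<partial>\<mu> \<partial>lborel) * indicator {0..} s \<partial>lborel)"
    by (rule nn_integral_restrict_space) simp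
  also have "\<dots> = integrand_sqnorm M \<mu> X"
    unfolding integrand_sqnorm_def
  proof (rule nn_integral_cong)
    fix s :: real
    show "(\<integral>\<^sup>+y. \<integral>\<^sup>+h. \<integral>\<^sup>+\<omega>. ?f s y h \<omega> \<partial>M \<partial>\<mu> \<partial>lborel) * indicator {0..} s =
      (\<integral>\<^sup>+y. \<integral>\<^sup>+h. \<integral>\<^sup>+\<omega>. ennreal ((X s (y, h) \<omega>)\<^sup>2) \<partial>M \<partial>\<mu> \<partial>lborel) * indicator {0<..} s"
      by (cases "0 < s"; cases "s = 0") (simp_all add: time_ext_def)
  qed
  finally show ?thesis ..
qed

section \<open>The isometry for simple integrands\<close>

lemma box_intensity:
  assumes "0 \<le> a" "A \<in> sets borel" "emeasure lborel A < \<infinity>" "H \<in> sets borel" "emeasure \<mu> H < \<infinity>"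
  shows "{a<..b} \<times> A \<times> H \<in> sets (noise_intensity \<mu>)"
    and "emeasure (noise_intensity \<mu>) ({a<..b} \<times> A \<times> H) < \<infinity>"
proof -
  interpret S: sigma_finite_measure "lborel \<Otimes>\<^sub>M \<mu>" by (rule sigma_finite_space_part)
  have I: "{a<..b} \<in> sets (restrict_space lborel {0..})"
    using assms(1) by (subst sets_restrict_space_iff) auto
  have AH: "A \<times> H \<in> sets (lborel \<Otimes>\<^sub>M \<mu>)" using assms by (intro pair_measureI) (auto simp: sets_\<mu>)
  show "{a<..b} \<times> A \<times> H \<in> sets (noise_intensity \<mu>)"
    unfolding noise_intensity_def by (rule pair_measureI[OF I AH])
  have "emeasure (restrict_space lborel {0..}) {a<..b} = emeasure lborel {a<..b}"
    using assms(1) by (intro emeasure_restrict_space) auto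
  also have "\<dots> < \<infinity>" by (cases "a \<le> b") auto
  finally have "emeasure (restrict_space lborel {0..}) {a<..b} < \<infinity>" .
  then show "emeasure (noise_intensity \<mu>) ({a<..b} \<times> A \<times> H) < \<infinity>"
    unfolding noise_intensity_def S.emeasure_pair_measure_Times[OF I AH]
    using assms by (subst mu.emeasure_pair_measure_Times) (auto simp: sets_\<mu> ennreal_mult_less_top)
qed

lemma slab_sets: "{0..t} \<times> UNIV \<in> sets (noise_intensity \<mu>)"
  unfolding noise_intensity_def
proof (rule pair_measureI)
  show "{0..t} \<in> sets (restrict_space lborel {0..})" by (subst sets_restrict_space_iff) auto
  show "UNIV \<in> sets (lborel \<Otimes>\<^sub>M \<mu>)"
    using sets.top[of "lborel \<Otimes>\<^sub>M \<mu>"] by (simp add: space_pair_measure space_\<mu>)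
qed

text \<open>The boxes of a simple integrand may overlap, so cross terms remain. Squaring the
  integrand and squaring the integral yield the same double sum of E(Y_i Y_j) times the intensity of
  the intersection of the boxes.\<close>

lemma simple_integral_isometry:
  assumes "simple_integral_pair M \<mu> N X I"
  shows "time_ext X \<in> borel_measurable (noise_intensity \<mu> \<Otimes>\<^sub>M M)"
    and "has_bochner_integral M I 0"
    and "integrable M (\<lambda>\<omega>. (I \<omega>)\<^sup>2)"
    and "integrand_sqnorm M \<mu> X = (\<integral>\<^sup>+\<omega>. ennreal ((I \<omega>)\<^sup>2) \<partial>M)"
proof -
  interpret PP: pair_sigma_finite "noise_intensity \<mu>" M by (rule pair_sigma_finite_intensity)
  obtain n :: nat and Y a b A H where
    ass: "\<And>i. i < n \<Longrightarrow> 0 \<le> a i \<and> a i < b i \<and>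
           Y i \<in> borel_measurable (noise_filtration M \<mu> N (a i)) \<and> bounded (Y i ` space M) \<and>
           A i \<in> sets borel \<and> emeasure lborel (A i) < \<infinity> \<and>
           H i \<in> sets borel \<and> emeasure \<mu> (H i) < \<infinity>"
    and X: "X = (\<lambda>s z \<omega>. \<Sum>i<n. Y i \<omega> * indicator ({a i<..b i} \<times> A i \<times> H i) (s, z))"
    and I: "I = (\<lambda>\<omega>. \<Sum>i<n. Y i \<omega> *
               compensated (noise_intensity \<mu>) N ({a i<..b i} \<times> A i \<times> H i) \<omega>)"
    using assms unfolding simple_integral_pair_def by blast
  define B where "B = (\<lambda>i. {a i<..b i} \<times> A i \<times> H i)"
  let ?X = "\<lambda>i. compensated (noise_intensity \<mu>) N (B i)"
  have B: "B i \<in> sets (noise_intensity \<mu>)" "emeasure (noise_intensity \<mu>) (B i) < \<infinity>" if "i < n" for i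
    using box_intensity[of "a i" "A i" "H i" "b i"] ass[OF that] by (simp_all add: B_def)
  have Yp: "Y i \<in> borel_measurable (past ({0..a i} \<times> UNIV))" if "i < n" for i
    using ass[OF that] by (simp add: noise_filtration_eq_past)
  have YM: "Y i \<in> borel_measurable M" if "i < n" for i
    by (rule past_measurable[OF Yp[OF that]])
  have bnd: "\<exists>K. \<forall>\<omega>\<in>space M. \<bar>Y i \<omega>\<bar> \<le> K" if "i < n" for i
    using ass[OF that] by (auto simp: bounded_iff)
  have ZZ: "bounded ((\<lambda>\<omega>. Y i \<omega> * Y j \<omega>) ` space M)" if ij: "i < n" "j < n" for i j
  proof -
    obtain K L where K: "\<forall>\<omega>\<in>space M. \<bar>Y i \<omega>\<bar> \<le> K" and L: "\<forall>\<omega>\<in>space M. \<bar>Y j \<omega>\<bar> \<le> L"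
      using bnd ij by blast
    have "\<bar>Y i \<omega> * Y j \<omega>\<bar> \<le> K * L" if "\<omega> \<in> space M" for \<omega>
      unfolding abs_mult using K L that by (intro mult_mono) (auto intro: order_trans[OF abs_ge_zero])
    then show ?thesis unfolding bounded_iff by auto
  qed
  have Zi: "integrable M (\<lambda>\<omega>. Y i \<omega> * Y j \<omega>)" if ij: "i < n" "j < n" for i j
  proof -
    obtain K where "\<And>\<omega>. \<omega> \<in> space M \<Longrightarrow> \<bar>Y i \<omega> * Y j \<omega>\<bar> \<le> K"
      using ZZ[OF ij] unfolding bounded_iff by auto
    then show ?thesis using YM ij by (intro integrable_const_bound[of _ K]) auto
  qed
  have Yi: "integrable M (Y i)" if i: "i < n" for i
  proof -
    obtain K where "\<And>\<omega>. \<omega> \<in> space M \<Longrightarrow> \<bar>Y i \<omega>\<bar> \<le> K" using bnd[OF i] by blast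
    then show ?thesis using YM i by (intro integrable_const_bound[of _ K]) auto
  qed
  define c where "c = (\<lambda>i j. expectation (\<lambda>\<omega>. Y i \<omega> * Y j \<omega>) * measure (noise_intensity \<mu>) (B i \<inter> B j))"
  \<comment> \<open>The past is taken at the later start \<open>a j\<close>: both weights are known
    by then, and the box \<open>B j\<close> is disjoint from the slab up to \<open>a j\<close>,
    whereas \<open>B i\<close> may reach into it.\<close>
  have cross_le: "has_bochner_integral M (\<lambda>\<omega>. Y i \<omega> * Y j \<omega> * (?X i \<omega> * ?X j \<omega>)) (c i j)"
    if ij: "i < n" "j < n" "a i \<le> a j" for i j
    unfolding c_def
  proof (rule integral_elementary_mult)
    show "(\<lambda>\<omega>. Y i \<omega> * Y j \<omega>) \<in> borel_measurable (past ({0..a j} \<times> UNIV))"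
      using ij by (intro borel_measurable_times past_measurable_mono[OF Yp[OF ij(1)]] Yp) auto
  qed (use ZZ B ij slab_sets in \<open>auto simp: B_def\<close>)
  have cross: "has_bochner_integral M (\<lambda>\<omega>. (Y i \<omega> * ?X i \<omega>) * (Y j \<omega> * ?X j \<omega>)) (c i j)"
    if ij: "i < n" "j < n" for i j
  proof (cases "a i \<le> a j")
    case True
    from cross_le[OF ij True] show ?thesis by (simp add: mult_ac)
  next
    case False
    then have "a j \<le> a i" by simp
    from cross_le[OF ij(2,1) this] show ?thesis by (simp add: mult_ac c_def Int_commute)
  qed
  have I': "I = (\<lambda>\<omega>. \<Sum>i<n. Y i \<omega> * ?X i \<omega>)" unfolding I B_def ..
  have Isq: "has_bochner_integral M (\<lambda>\<omega>. (I \<omega>)\<^sup>2) (\<Sum>i<n. \<Sum>j<n. c i j)"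
    unfolding I' power2_eq_square sum_product
    by (intro has_bochner_integral_sum cross) auto
  show "integrable M (\<lambda>\<omega>. (I \<omega>)\<^sup>2)" using Isq by (simp add: has_bochner_integral_iff)
  have "has_bochner_integral M I (\<Sum>i<n. 0)"
    unfolding I'
    by (intro has_bochner_integral_sum integral_past_compensated(1)[OF Yp Yi B])
      (auto simp: B_def)
  then show "has_bochner_integral M I 0" by simp
  have te: "time_ext X = (\<lambda>p. \<Sum>i<n. Y i (snd p) * indicator (B i) (fst p))"
  proof
    fix p :: "(real \<times> 'a \<times> 'a) \<times> 'w"
    obtain s z \<omega> where p: "p = ((s, z), \<omega>)" by (metis surj_pair)
    have XB: "X = (\<lambda>s z \<omega>. \<Sum>i<n. Y i \<omega> * indicator (B i) (s, z))" unfolding X B_def ..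
    \<comment> \<open>Since \<open>0 \<le> a i\<close>, every box lies in strictly positive times
      and the cut-off changes nothing.\<close>
    have "indicator {0<..} s * (Y i \<omega> * indicator (B i) (s, z)) = Y i \<omega> * (indicator (B i) (s, z) :: real)"
      if "i < n" for i
      using ass[OF that] by (auto simp: B_def split: split_indicator)
    then show "time_ext X p = (\<Sum>i<n. Y i (snd p) * indicator (B i) (fst p))"
      unfolding p time_ext_def XB prod.case sum_distrib_left fst_conv snd_conv by (intro sum.cong) auto
  qed
  show m: "time_ext X \<in> borel_measurable (noise_intensity \<mu> \<Otimes>\<^sub>M M)"
    unfolding te using YM B
    by (intro borel_measurable_sum borel_measurable_times measurable_compose[OF measurable_snd]
        measurable_compose[OF measurable_fst borel_measurable_indicator]) auto
  have Xsq: "has_bochner_integral (noise_intensity \<mu> \<Otimes>\<^sub>M M) (\<lambda>p. (time_ext X p)\<^sup>2) (\<Sum>i<n. \<Sum>j<n. c i j)"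
    unfolding te power2_eq_square sum_product
  proof (intro has_bochner_integral_sum)
    fix i j assume ij: "i \<in> {..<n}" "j \<in> {..<n}"
    have fin: "emeasure (noise_intensity \<mu>) (B i \<inter> B j) < \<infinity>"
      using emeasure_mono[of "B i \<inter> B j" "B i"] B[of i] ij by (auto intro: le_less_trans)
    have "has_bochner_integral (noise_intensity \<mu> \<Otimes>\<^sub>M M)
        (\<lambda>(z, \<omega>). indicator (B i \<inter> B j) z * (Y i \<omega> * Y j \<omega>)) (c i j)"
      unfolding c_def mult.commute[of "expectation _"]
      using ij B Zi fin by (intro PP.has_bochner_integral_indicator_mult) auto
    then show "has_bochner_integral (noise_intensity \<mu> \<Otimes>\<^sub>M M)
        (\<lambda>p. Y i (snd p) * indicator (B i) (fst p) * (Y j (snd p) * indicator (B j) (fst p))) (c i j)"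
      by (simp add: case_prod_unfold indicator_inter_arith mult_ac)
  qed
  have "integrand_sqnorm M \<mu> X = ennreal (\<Sum>i<n. \<Sum>j<n. c i j)"
    unfolding integrand_sqnorm_eq[OF m] using Xsq
    by (subst nn_integral_eq_integral) (auto simp: has_bochner_integral_iff)
  also have "\<dots> = (\<integral>\<^sup>+\<omega>. ennreal ((I \<omega>)\<^sup>2) \<partial>M)"
    using Isq by (subst nn_integral_eq_integral) (auto simp: has_bochner_integral_iff)
  finally show "integrand_sqnorm M \<mu> X = (\<integral>\<^sup>+\<omega>. ennreal ((I \<omega>)\<^sup>2) \<partial>M)" .
qed

text \<open>All three claims pass to the L2 limit from simple integrals, whose mean is zero and
  whose norms agree by the isometry.\<close>

lemma compensated_integral_second_moment:
  assumes "has_compensated_integral M \<mu> N X I"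
  shows "has_bochner_integral M I 0"
    and "integrable M (\<lambda>\<omega>. (I \<omega>)\<^sup>2)"
    and "integrand_sqnorm M \<mu> X \<le> (\<integral>\<^sup>+\<omega>. ennreal ((I \<omega>)\<^sup>2) \<partial>M)"
proof -
  let ?P = "noise_intensity \<mu> \<Otimes>\<^sub>M M"
  let ?E = "\<lambda>f. \<integral>\<^sup>+\<omega>. ennreal ((f \<omega> :: real)\<^sup>2) \<partial>M"
  from assms obtain S J where
    pred: "predictable_field M (noise_filtration M \<mu> N) X" and
    I[measurable]: "I \<in> borel_measurable M" and
    simple: "\<And>n::nat. simple_integral_pair M \<mu> N (S n) (J n)" and
    Slim: "(\<lambda>n. integrand_sqnorm M \<mu> (\<lambda>s z \<omega>. S n s z \<omega> - X s z \<omega>)) \<longlonglongrightarrow> 0" and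
    Jlim: "(\<lambda>n. ?E (\<lambda>\<omega>. J n \<omega> - I \<omega>)) \<longlonglongrightarrow> 0"
    unfolding has_compensated_integral_def by blast
  note iso = simple_integral_isometry[OF simple]
  have [measurable]: "time_ext X \<in> borel_measurable ?P" "\<And>n. time_ext (S n) \<in> borel_measurable ?P"
    by (rule time_ext_measurable[OF pred], rule iso(1))
  have J[measurable]: "J n \<in> borel_measurable M" for n
    using iso(2)[of n] by (auto intro: borel_measurable_has_bochner_integral)
  have diff: "time_ext (\<lambda>s z \<omega>. S n s z \<omega> - X s z \<omega>) = (\<lambda>p. time_ext (S n) p - time_ext X p)" for n
    by (auto simp: time_ext_def fun_eq_iff algebra_simps)
  define \<delta> where "\<delta> = (\<lambda>n. \<integral>\<^sup>+p. ennreal ((time_ext (S n) p - time_ext X p)\<^sup>2) \<partial>?P)"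
  have \<delta>: "\<delta> \<longlonglongrightarrow> 0"
    using Slim by (subst (asm) integrand_sqnorm_eq) (simp_all add: diff \<delta>_def[abs_def])
  have J2: "?E (J n) < \<infinity>" for n
    using iso(3)[of n] by (subst nn_integral_eq_integral) auto
  \<comment> \<open>A single approximant at finite L2 distance suffices, since its own second moment
    is finite.\<close>
  have I_fin: "?E I < \<infinity>"
  proof -
    obtain n where n: "?E (\<lambda>\<omega>. J n \<omega> - I \<omega>) < 1"
      using order_tendstoD(2)[OF Jlim, of 1] by (auto simp: eventually_sequentially)
    have "?E I \<le> ennreal (1 + 1) * ?E (J n) + ennreal (1 + 1 / 1) * ?E (\<lambda>\<omega>. J n \<omega> - I \<omega>)"
      by (rule nn_integral_square_le) simp_all
    also have "\<dots> < \<infinity>" using J2[of n] less_trans[OF n ennreal_one_less_top]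
      by (simp add: ennreal_mult_less_top ennreal_numeral_less_top)
    finally show ?thesis .
  qed
  then show I2: "integrable M (\<lambda>\<omega>. (I \<omega>)\<^sup>2)"
    by (intro integrableI_nonneg) auto
  then have Iint: "integrable M I"
    by (rule square_integrable_imp_integrable[OF I])
  have Jint: "integrable M (J n)" and J0: "expectation (J n) = 0" for n
    using iso(2)[of n] by (auto simp: has_bochner_integral_iff)
  \<comment> \<open>As \<open>J n\<close> has mean zero, the mean of \<open>I\<close> is up to sign
    that of \<open>J n - I\<close>, and a squared mean is at most the second moment.\<close>
  have EI: "ennreal ((expectation I)\<^sup>2) \<le> ?E (\<lambda>\<omega>. J n \<omega> - I \<omega>)" for n
  proof -
    have m: "(\<lambda>\<omega>. (J n \<omega> - I \<omega>)\<^sup>2) \<in> borel_measurable M" by measurable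
    show ?thesis
    proof (cases "?E (\<lambda>\<omega>. J n \<omega> - I \<omega>) < \<infinity>")
      case True
      then have sq: "integrable M (\<lambda>\<omega>. (J n \<omega> - I \<omega>)\<^sup>2)" by (intro integrableI_nonneg m) auto
      have int: "integrable M (\<lambda>\<omega>. J n \<omega> - I \<omega>)" using Iint Jint by simp
      have "(expectation I)\<^sup>2 = (expectation (\<lambda>\<omega>. J n \<omega> - I \<omega>))\<^sup>2" using Iint Jint J0 by simp
      also have "\<dots> \<le> expectation (\<lambda>\<omega>. (J n \<omega> - I \<omega>)\<^sup>2)"
        using variance_eq[OF int sq] variance_positive[of "\<lambda>\<omega>. J n \<omega> - I \<omega>"] by linarith
      finally show ?thesis using sq by (subst nn_integral_eq_integral) (auto intro: ennreal_leI)
    qed (simp add: not_less top_unique)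
  qed
  have "ennreal ((expectation I)\<^sup>2) \<le> 0"
    by (rule tendsto_lowerbound[OF Jlim always_eventually[OF allI[OF EI]]]) simp
  then have "expectation I = 0" by simp
  then show "has_bochner_integral M I 0" using Iint by (simp add: has_bochner_integral_iff)
  \<comment> \<open>Young's inequality is used twice, from \<open>X\<close> to \<open>S n\<close>
    and, through the isometry, from \<open>J n\<close> to \<open>I\<close>. Both error terms vanish
    as \<open>n\<close> grows, leaving the square of 1 + e.\<close>
  have step: "integrand_sqnorm M \<mu> X \<le> ennreal (1 + e) * (ennreal (1 + e) * ?E I)" if e: "0 < e" for e
  proof (rule tendsto_lowerbound)
    have "(\<lambda>n. ennreal (1 + e) * (ennreal (1 + e) * ?E I + ennreal (1 + 1 / e) * ?E (\<lambda>\<omega>. J n \<omega> - I \<omega>)) +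
      ennreal (1 + 1 / e) * \<delta> n) \<longlonglongrightarrow>
      ennreal (1 + e) * (ennreal (1 + e) * ?E I + ennreal (1 + 1 / e) * 0) + ennreal (1 + 1 / e) * 0"
      by (intro tendsto_add ennreal_tendsto_cmult tendsto_const Jlim \<delta>) auto
    then show "(\<lambda>n. ennreal (1 + e) * (ennreal (1 + e) * ?E I + ennreal (1 + 1 / e) * ?E (\<lambda>\<omega>. J n \<omega> - I \<omega>)) +
      ennreal (1 + 1 / e) * \<delta> n) \<longlonglongrightarrow> ennreal (1 + e) * (ennreal (1 + e) * ?E I)" by simp
    have "integrand_sqnorm M \<mu> X \<le> ennreal (1 + e) * (ennreal (1 + e) * ?E I +
        ennreal (1 + 1 / e) * ?E (\<lambda>\<omega>. J n \<omega> - I \<omega>)) + ennreal (1 + 1 / e) * \<delta> n" for n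
    proof -
      have sym: "?E (\<lambda>\<omega>. I \<omega> - J n \<omega>) = ?E (\<lambda>\<omega>. J n \<omega> - I \<omega>)"
        by (simp add: power2_commute)
      have "integrand_sqnorm M \<mu> X = (\<integral>\<^sup>+p. ennreal ((time_ext X p)\<^sup>2) \<partial>?P)"
        by (rule integrand_sqnorm_eq) measurable
      also have "\<dots> \<le> ennreal (1 + e) * (\<integral>\<^sup>+p. ennreal ((time_ext (S n) p)\<^sup>2) \<partial>?P) + ennreal (1 + 1 / e) * \<delta> n"
        unfolding \<delta>_def by (rule nn_integral_square_le[OF _ _ e]) measurable
      also have "(\<integral>\<^sup>+p. ennreal ((time_ext (S n) p)\<^sup>2) \<partial>?P) = ?E (J n)"
        using iso(4)[of n] integrand_sqnorm_eq[of "S n"] by simp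
      also have "?E (J n) \<le> ennreal (1 + e) * ?E I + ennreal (1 + 1 / e) * ?E (\<lambda>\<omega>. J n \<omega> - I \<omega>)"
        unfolding sym[symmetric] by (rule nn_integral_square_le[OF _ _ e]) measurable
      finally show ?thesis by (simp add: add_mono mult_left_mono)
    qed
    then show "\<forall>\<^sub>F n in sequentially. integrand_sqnorm M \<mu> X \<le> ennreal (1 + e) * (ennreal (1 + e) * ?E I +
        ennreal (1 + 1 / e) * ?E (\<lambda>\<omega>. J n \<omega> - I \<omega>)) + ennreal (1 + 1 / e) * \<delta> n"
      by (rule always_eventually[OF allI])
  qed simp
  show "integrand_sqnorm M \<mu> X \<le> ?E I"
  proof (rule tendsto_lowerbound)
    \<comment> \<open>Taking e = 1/(n + 1), the last limit can be computed in the reals because the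
      second moment of \<open>I\<close> is finite.\<close>
    obtain c where c: "?E I = ennreal c" "0 \<le> c" using I_fin by (cases "?E I") auto
    have "(\<lambda>n. (1 + 1 / real (Suc n)) * ((1 + 1 / real (Suc n)) * c)) \<longlonglongrightarrow> (1 + 0) * ((1 + 0) * c)"
      by (intro tendsto_intros LIMSEQ_Suc[OF lim_1_over_n])
    then have "(\<lambda>n. ennreal ((1 + 1 / real (Suc n)) * ((1 + 1 / real (Suc n)) * c))) \<longlonglongrightarrow> ennreal c"
      by (intro tendsto_ennrealI) simp
    then show "(\<lambda>n. ennreal (1 + 1 / real (Suc n)) * (ennreal (1 + 1 / real (Suc n)) * ?E I)) \<longlonglongrightarrow> ?E I"
      unfolding c(1) using c(2) by (simp only: ennreal_mult[symmetric] mult_nonneg_nonneg add_nonneg_nonneg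
          zero_le_one zero_le_divide_1_iff of_nat_0_le_iff)
    show "\<forall>\<^sub>F n in sequentially. integrand_sqnorm M \<mu> X \<le> ennreal (1 + 1 / real (Suc n)) * (ennreal (1 + 1 / real (Suc n)) * ?E I)"
      by (intro always_eventually allI step) simp
  qed simp
qed

end

section \<open>The renewal inequality\<close>

lemma nn_integral_lborel_reflect:
  fixes f :: "'a::euclidean_space \<Rightarrow> ennreal"
  assumes [measurable]: "f \<in> borel_measurable borel"
  shows "(\<integral>\<^sup>+y. f (x - y) \<partial>lborel) = (\<integral>\<^sup>+y. f y \<partial>lborel)"
proof -
  have "(\<integral>\<^sup>+y. f y \<partial>lborel) =
      (\<integral>\<^sup>+y. f y \<partial>density (distr lborel borel (\<lambda>y. x + (- 1) *\<^sub>R y)) (\<lambda>_. ennreal (\<bar>- 1\<bar> ^ DIM('a))))"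
    by (subst lborel_affine[of "- 1" x, symmetric]) simp_all
  also have "\<dots> = (\<integral>\<^sup>+y. f (x - y) \<partial>lborel)"
    by (simp add: nn_integral_density nn_integral_distr)
  finally show ?thesis ..
qed

text \<open>Picard iterates of the renewal equation h = c + k (b convolved with h). The indicator
  supplies the lower limit 0 of the convolution; its upper limit \<open>t\<close> results from
  \<open>b\<close> vanishing at nonpositive times.\<close>

primrec renewal :: "(real \<Rightarrow> ennreal) \<Rightarrow> ennreal \<Rightarrow> ennreal \<Rightarrow> nat \<Rightarrow> real \<Rightarrow> ennreal" where
  "renewal b k c 0 t = c"
| "renewal b k c (Suc n) t =
     c + k * (\<integral>\<^sup>+s. b (t - s) * (indicator {0<..} s * renewal b k c n s) \<partial>lborel)"

lemma renewal_measurable [measurable]: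
  assumes [measurable]: "b \<in> borel_measurable borel"
  shows "renewal b k c n \<in> borel_measurable borel"
proof (induction n)
  case 0
  have "renewal b k c 0 = (\<lambda>_. c)" by auto
  then show ?case by simp
next
  case (Suc n)
  note [measurable] = Suc
  have "renewal b k c (Suc n) =
      (\<lambda>t. c + k * (\<integral>\<^sup>+s. b (t - s) * (indicator {0<..} s * renewal b k c n s) \<partial>lborel))" by auto
  also have "\<dots> \<in> borel_measurable borel" by measurable
  finally show ?case .
qed

text \<open>The exponential factors along t = s + (t - s); Tonelli and a translation in
  \<open>t\<close> separate the two transforms.\<close>

lemma laplace_convolution:
  assumes [measurable]: "b \<in> borel_measurable borel" "h \<in> borel_measurable borel"
    and b0: "\<And>t. t \<le> 0 \<Longrightarrow> b t = 0"
  shows "(\<integral>\<^sup>+t\<in>{0<..}. ennreal (exp (- (l * t))) * (\<integral>\<^sup>+s. b (t - s) * (indicator {0<..} s * h s) \<partial>lborel) \<partial>lborel) =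
    (\<integral>\<^sup>+t. ennreal (exp (- (l * t))) * b t \<partial>lborel) * (\<integral>\<^sup>+t\<in>{0<..}. ennreal (exp (- (l * t))) * h t \<partial>lborel)"
proof -
  let ?e = "\<lambda>t. ennreal (exp (- (l * t)))"
  have e_add: "?e t = ?e s * ?e (t - s)" for s t
    by (simp add: algebra_simps flip: ennreal_mult' exp_add)
  have "(\<integral>\<^sup>+t\<in>{0<..}. ?e t * (\<integral>\<^sup>+s. b (t - s) * (indicator {0<..} s * h s) \<partial>lborel) \<partial>lborel) =
      (\<integral>\<^sup>+t. \<integral>\<^sup>+s. ?e t * (b (t - s) * (indicator {0<..} s * h s)) \<partial>lborel \<partial>lborel)"
  proof (rule nn_integral_cong)
    fix t :: real
    show "?e t * (\<integral>\<^sup>+s. b (t - s) * (indicator {0<..} s * h s) \<partial>lborel) * indicator {0<..} t =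
        (\<integral>\<^sup>+s. ?e t * (b (t - s) * (indicator {0<..} s * h s)) \<partial>lborel)"
    \<comment> \<open>At t \<le> 0 and s > 0 the argument t - s is negative and \<open>b\<close>
      vanishes there. Hence \<open>t\<close> may range over the whole line, which is invariant under
      the translation.\<close>
    proof (cases "0 < t")
      case False
      then have "b (t - s) * (indicator {0<..} s * h s) = 0" for s
        using b0[of "t - s"] by (cases "0 < s") auto
      then show ?thesis using False by (simp only: mult_zero_right nn_integral_const) simp
    qed (simp add: nn_integral_cmult)
  qed
  also have "\<dots> = (\<integral>\<^sup>+s. \<integral>\<^sup>+t. ?e t * (b (t - s) * (indicator {0<..} s * h s)) \<partial>lborel \<partial>lborel)"
    by (rule lborel_pair.Fubini') measurable
  also have "\<dots> = (\<integral>\<^sup>+s. (\<integral>\<^sup>+t. ?e t * b t \<partial>lborel) * (?e s * h s * indicator {0<..} s) \<partial>lborel)"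
  proof (rule nn_integral_cong)
    fix s :: real
    have "(\<integral>\<^sup>+t. ?e t * (b (t - s) * (indicator {0<..} s * h s)) \<partial>lborel) =
        (\<integral>\<^sup>+t. ?e s * h s * indicator {0<..} s * (?e (t - s) * b (t - s)) \<partial>lborel)"
      by (subst e_add[of _ s]) (simp add: mult_ac)
    also have "\<dots> = ?e s * h s * indicator {0<..} s * (\<integral>\<^sup>+t. ?e (t - s) * b (t - s) \<partial>lborel)"
      by (rule nn_integral_cmult) measurable
    also have "(\<integral>\<^sup>+t. ?e (t - s) * b (t - s) \<partial>lborel) = (\<integral>\<^sup>+t. ?e t * b t \<partial>lborel)"
      by (subst nn_integral_real_affine[of _ 1 s]) simp_all
    finally show "(\<integral>\<^sup>+t. ?e t * (b (t - s) * (indicator {0<..} s * h s)) \<partial>lborel) =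
        (\<integral>\<^sup>+t. ?e t * b t \<partial>lborel) * (?e s * h s * indicator {0<..} s)"
      by (simp only: mult.commute)
  qed
  also have "\<dots> = (\<integral>\<^sup>+t. ?e t * b t \<partial>lborel) * (\<integral>\<^sup>+t\<in>{0<..}. ?e t * h t \<partial>lborel)"
    by (rule nn_integral_cmult) measurable
  finally show ?thesis .
qed

text \<open>One iteration replaces the transform L by c/l + k B L, where B is the transform of
  \<open>b\<close>. As k B \<ge> 1, each step adds at least c/l.\<close>

lemma renewal_laplace_ge:
  assumes [measurable]: "b \<in> borel_measurable borel" and b0: "\<And>t. t \<le> 0 \<Longrightarrow> b t = 0" and l: "0 < l"
    and supercritical: "1 \<le> k * (\<integral>\<^sup>+t. ennreal (exp (- (l * t))) * b t \<partial>lborel)"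
  shows "of_nat (Suc n) * (c * ennreal (1 / l)) \<le>
    (\<integral>\<^sup>+t\<in>{0<..}. ennreal (exp (- (l * t))) * renewal b k c n t \<partial>lborel)"
proof (induction n)
  have c: "(\<integral>\<^sup>+t\<in>{0<..}. ennreal (exp (- (l * t))) * c \<partial>lborel) = c * ennreal (1 / l)"
  proof -
    have "(\<integral>\<^sup>+t\<in>{0<..}. ennreal (exp (- (l * t))) * c \<partial>lborel) =
        (\<integral>\<^sup>+t. c * (ennreal (exp (- (l * t))) * indicator {0<..} t) \<partial>lborel)"
      by (simp only: mult_ac)
    also have "\<dots> = c * ennreal (1 / l)"
      by (subst nn_integral_cmult) (simp_all add: nn_integral_exp_neg[OF l])
    finally show ?thesis .
  qed
  {
    case 0
    show ?case using c by simp
  next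
    case (Suc n)
    let ?L = "\<integral>\<^sup>+t\<in>{0<..}. ennreal (exp (- (l * t))) * renewal b k c n t \<partial>lborel"
    let ?B = "\<integral>\<^sup>+t. ennreal (exp (- (l * t))) * b t \<partial>lborel"
    let ?C = "\<lambda>t. \<integral>\<^sup>+s. b (t - s) * (indicator {0<..} s * renewal b k c n s) \<partial>lborel"
    have "(\<integral>\<^sup>+t\<in>{0<..}. ennreal (exp (- (l * t))) * renewal b k c (Suc n) t \<partial>lborel) =
        (\<integral>\<^sup>+t. ennreal (exp (- (l * t))) * c * indicator {0<..} t +
          k * (ennreal (exp (- (l * t))) * ?C t * indicator {0<..} t) \<partial>lborel)"
      by (intro nn_integral_cong) (simp add: distrib_left distrib_right mult_ac)
    also have "\<dots> = c * ennreal (1 / l) +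
        k * (\<integral>\<^sup>+t\<in>{0<..}. ennreal (exp (- (l * t))) * ?C t \<partial>lborel)"
      by (simp add: nn_integral_add nn_integral_cmult c)
    also have "(\<integral>\<^sup>+t\<in>{0<..}. ennreal (exp (- (l * t))) * ?C t \<partial>lborel) = ?B * ?L"
      by (rule laplace_convolution) (simp_all add: b0)
    also have "c * ennreal (1 / l) + k * (?B * ?L) \<ge> c * ennreal (1 / l) + 1 * ?L"
      using mult_right_mono[OF supercritical, of ?L] by (simp add: mult.assoc)
    finally show ?case using Suc by (simp add: distrib_right) (meson add_left_mono order_trans)
  }
qed

text \<open>The Fourier transform is evaluated at frequency zero, where
  \<open>norm 0 powr \<alpha>\<close> is 0 and the exponential is 1.\<close>

lemma stable_density_integral:
  assumes G: "stable_transition_density \<nu> \<alpha> G" and "0 < t"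
  shows "(\<integral>\<^sup>+y. ennreal (G t y) \<partial>lborel) = 1"
proof -
  have G': "\<And>y. 0 \<le> G t y" "integrable lborel (G t)"
    "(LINT x|lborel. complex_of_real (G t x) * cis (0 \<bullet> x)) = complex_of_real (exp (- t * \<nu> * norm (0::'a) powr \<alpha>))"
    using assms unfolding stable_transition_density_def by blast+
  from G'(3) have "complex_of_real (LINT x|lborel. G t x) = complex_of_real 1" by simp
  then have "(LINT x|lborel. G t x) = 1" by (simp only: of_real_eq_iff)
  then show ?thesis using G' by (simp add: nn_integral_eq_integral)
qed

text \<open>Averaging against a probability density preserves a lower bound. Boundedness of
  \<open>u0\<close> secures integrability, without which the Bochner integral would be 0.\<close>

lemma stable_semigroup_ge:
  assumes G: "stable_transition_density \<nu> \<alpha> G" and "0 < t"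
    and u0: "u0 \<in> borel_measurable borel" "bounded (range u0)" "\<And>y. c \<le> u0 y"
  shows "c \<le> (LINT y|lborel. G t (x - y) * u0 y)"
proof -
  have G': "\<And>y. 0 \<le> G t y" "integrable lborel (G t)"
    using assms unfolding stable_transition_density_def by blast+
  have [measurable]: "G t \<in> borel_measurable borel" "u0 \<in> borel_measurable borel"
    using G'(2) u0(1) by auto
  have "(\<integral>\<^sup>+y. ennreal (G t (x - y)) \<partial>lborel) = ennreal 1"
    using nn_integral_lborel_reflect[of "\<lambda>y. ennreal (G t y)" x] stable_density_integral[OF assms(1,2)]
    by simp
  then have "has_bochner_integral lborel (\<lambda>y. G t (x - y)) 1"
    using G'(1) by (intro has_bochner_integral_nn_integral) auto
  then have int: "integrable lborel (\<lambda>y. G t (x - y))" and 1: "(LINT y|lborel. G t (x - y)) = 1"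
    by (auto simp: has_bochner_integral_iff)
  obtain K where K: "\<And>y. \<bar>u0 y\<bar> \<le> K" using u0(2) by (auto simp: bounded_iff)
  have "integrable lborel (\<lambda>y. G t (x - y) * u0 y)"
  proof (rule Bochner_Integration.integrable_bound)
    show "integrable lborel (\<lambda>y. G t (x - y) * K)" using int by simp
    show "AE y in lborel. norm (G t (x - y) * u0 y) \<le> norm (G t (x - y) * K)"
      using order_trans[OF K abs_ge_self] by (auto simp: abs_mult intro!: AE_I2 mult_left_mono)
  qed measurable
  then have "(LINT y|lborel. G t (x - y) * c) \<le> (LINT y|lborel. G t (x - y) * u0 y)"
    using int u0(3) G'(1) by (intro integral_mono) (auto intro: mult_left_mono)
  then show ?thesis using 1 by simp
qed

text \<open>The squared L2 norm of the kernel in space, the function b of the overview. The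
  indicator discards times at which \<open>G\<close> is unspecified and ends the renewal convolution
  at \<open>t\<close>.\<close>

definition energy :: "(real \<Rightarrow> 'a::euclidean_space \<Rightarrow> real) \<Rightarrow> real \<Rightarrow> ennreal" where
  "energy G t = indicator {0<..} t * (\<integral>\<^sup>+y. ennreal ((G t y)\<^sup>2) \<partial>lborel)"

lemma energy_measurable:
  assumes "stable_transition_density \<nu> \<alpha> G"
  shows "energy G \<in> borel_measurable borel"
proof -
  have [measurable]: "(\<lambda>(t, x). G t x) \<in> borel_measurable (restrict_space borel {0<..} \<Otimes>\<^sub>M borel)"
    using assms by (simp add: stable_transition_density_def)
  have "(\<lambda>t. \<integral>\<^sup>+y. ennreal ((G t y)\<^sup>2) \<partial>lborel) \<in> borel_measurable (restrict_space borel {0<..})"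
    by measurable
  then show ?thesis
    unfolding energy_def[abs_def]
    by (subst (asm) borel_measurable_restrict_space_iff_ennreal) (simp_all add: mult.commute)
qed

context levy_noise begin

text \<open>The stochastic integral has mean zero, so the second moment splits into the squared
  deterministic part, at least c^2, and the second moment of the integral. The latter dominates the
  norm of the integrand, to which the lower bound on \<sigma> is applied. The function
  \<open>r\<close> replaces the infimum over space.\<close>

lemma mild_solution_second_moment_ge:
  assumes sol: "mild_solution M \<mu> N G \<sigma> u0 u"
    and G: "stable_transition_density \<nu> \<alpha> G"
    and u0: "u0 \<in> borel_measurable borel" "bounded (range u0)" "\<And>y. c \<le> u0 y" "0 \<le> c"
    and J': "J' \<in> borel_measurable borel" "\<And>h. 0 < J' h"
    and lower: "\<And>x h. \<bar>\<sigma> x h\<bar> \<ge> L * J' h * \<bar>x\<bar>" and "0 < L" "0 < \<kappa>"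
    and J'_int: "(\<integral>\<^sup>+h. ennreal ((J' h)\<^sup>2) \<partial>\<mu>) \<ge> ennreal \<kappa>"
    and r: "\<And>s y. 0 < s \<Longrightarrow> r s \<le> (\<integral>\<^sup>+\<omega>. ennreal ((u s y \<omega>)\<^sup>2) \<partial>M)"
    and r_meas: "r \<in> borel_measurable borel"
    and t: "0 < t"
  shows "ennreal (c\<^sup>2) + ennreal (\<kappa> * L\<^sup>2) *
      (\<integral>\<^sup>+s. energy G (t - s) * (indicator {0<..} s * r s) \<partial>lborel) \<le>
    (\<integral>\<^sup>+\<omega>. ennreal ((u t x \<omega>)\<^sup>2) \<partial>M)"
proof -
  note [measurable] = J'(1) energy_measurable[OF G] r_meas
  have pred: "predictable_field M (noise_filtration M \<mu> N) u"
    using sol by (simp add: mild_solution_def)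
  have u_meas: "u s y \<in> borel_measurable M" if "0 < s" for s y
    by (rule predictable_field_section_measurable[OF pred noise_filtration_subset that])
  define X where "X = (\<lambda>s (y, h) \<omega>. indicator {0<..<t} s * (G (t - s) (x - y) * \<sigma> (u s y \<omega>) h))"
  define m where "m = (LINT y|lborel. G t (x - y) * u0 y)"
  obtain I where I: "has_compensated_integral M \<mu> N X I" and uI: "AE \<omega> in M. u t x \<omega> = m + I \<omega>"
    using sol t unfolding mild_solution_def X_def m_def by blast
  note mom = compensated_integral_second_moment[OF I]
  have m: "c \<le> m" unfolding m_def by (rule stable_semigroup_ge[OF G t u0(1,2,3)])
  have Gm[measurable]: "G s \<in> borel_measurable borel" if "0 < s" for s
    using G that by (auto simp: stable_transition_density_def)
  have "(\<integral>\<^sup>+\<omega>. ennreal ((u t x \<omega>)\<^sup>2) \<partial>M) = (\<integral>\<^sup>+\<omega>. ennreal ((m + I \<omega>)\<^sup>2) \<partial>M)"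
    using uI by (intro nn_integral_cong_AE) (auto elim: eventually_mono)
  also have "\<dots> = ennreal (m\<^sup>2 + expectation (\<lambda>\<omega>. (I \<omega>)\<^sup>2))"
  proof -
    have "has_bochner_integral M (\<lambda>\<omega>. m\<^sup>2 + 2 * m * I \<omega> + (I \<omega>)\<^sup>2) (m\<^sup>2 + 2 * m * 0 + expectation (\<lambda>\<omega>. (I \<omega>)\<^sup>2))"
      using mom(1,2) by (intro has_bochner_integral_add has_bochner_integral_mult_right)
        (auto simp: has_bochner_integral_iff prob_space)
    then have "has_bochner_integral M (\<lambda>\<omega>. (m + I \<omega>)\<^sup>2) (m\<^sup>2 + expectation (\<lambda>\<omega>. (I \<omega>)\<^sup>2))"
      by (simp add: power2_sum algebra_simps)
    then show ?thesis by (subst nn_integral_eq_integral) (auto simp: has_bochner_integral_iff)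
  qed
  also have "\<dots> = ennreal (m\<^sup>2) + (\<integral>\<^sup>+\<omega>. ennreal ((I \<omega>)\<^sup>2) \<partial>M)"
    using mom(2) by (subst nn_integral_eq_integral) (auto intro: ennreal_plus)
  finally have second: "(\<integral>\<^sup>+\<omega>. ennreal ((u t x \<omega>)\<^sup>2) \<partial>M) = ennreal (m\<^sup>2) + (\<integral>\<^sup>+\<omega>. ennreal ((I \<omega>)\<^sup>2) \<partial>M)" .
  \<comment> \<open>At fixed \<open>s\<close> the integrals over \<omega>, \<open>h\<close> and
    \<open>y\<close> are bounded below in turn and contribute \<open>r s\<close>, \<kappa> and the
    energy. Outside 0 < s < t the left side vanishes.\<close>
  have inner: "ennreal (\<kappa> * L\<^sup>2) * (energy G (t - s) * (indicator {0<..} s * r s)) \<le>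
      (\<integral>\<^sup>+y. \<integral>\<^sup>+h. \<integral>\<^sup>+\<omega>. ennreal ((X s (y, h) \<omega>)\<^sup>2) \<partial>M \<partial>\<mu> \<partial>lborel) * indicator {0<..} s" for s
  proof (cases "0 < s \<and> s < t")
    case False
    then show ?thesis by (auto simp: energy_def split: split_indicator)
  next
    case True
    then have s: "0 < s" "0 < t - s" "s \<in> {0<..<t}" by auto
    note [measurable] = Gm[OF s(2)] u_meas[OF s(1)]
    let ?g = "\<lambda>y. ennreal ((G (t - s) y)\<^sup>2)"
    have om: "ennreal (L\<^sup>2) * r s * ?g (x - y) * ennreal ((J' h)\<^sup>2) \<le> (\<integral>\<^sup>+\<omega>. ennreal ((X s (y, h) \<omega>)\<^sup>2) \<partial>M)" for y h
    proof -
      have "ennreal (L\<^sup>2) * r s * ?g (x - y) * ennreal ((J' h)\<^sup>2) =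
          ennreal ((G (t - s) (x - y) * L * J' h)\<^sup>2) * r s"
        by (simp add: power_mult_distrib ennreal_mult' mult_ac)
      also have "\<dots> \<le> ennreal ((G (t - s) (x - y) * L * J' h)\<^sup>2) * (\<integral>\<^sup>+\<omega>. ennreal ((u s y \<omega>)\<^sup>2) \<partial>M)"
        by (intro mult_left_mono r s) simp
      also have "\<dots> = (\<integral>\<^sup>+\<omega>. ennreal ((G (t - s) (x - y) * L * J' h)\<^sup>2) * ennreal ((u s y \<omega>)\<^sup>2) \<partial>M)"
        by (rule nn_integral_cmult[symmetric]) measurable
      also have "\<dots> \<le> (\<integral>\<^sup>+\<omega>. ennreal ((X s (y, h) \<omega>)\<^sup>2) \<partial>M)"
      proof (rule nn_integral_mono)
        fix \<omega>
        have "(L * J' h * \<bar>u s y \<omega>\<bar>)\<^sup>2 \<le> \<bar>\<sigma> (u s y \<omega>) h\<bar>\<^sup>2"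
          using lower[of h "u s y \<omega>"] \<open>0 < L\<close> J'(2)[of h] by (intro power_mono) auto
        then have "(G (t - s) (x - y))\<^sup>2 * (L * J' h * \<bar>u s y \<omega>\<bar>)\<^sup>2 \<le> (G (t - s) (x - y))\<^sup>2 * (\<sigma> (u s y \<omega>) h)\<^sup>2"
          by (intro mult_left_mono) auto
        then show "ennreal ((G (t - s) (x - y) * L * J' h)\<^sup>2) * ennreal ((u s y \<omega>)\<^sup>2) \<le> ennreal ((X s (y, h) \<omega>)\<^sup>2)"
          using s by (subst ennreal_mult'[symmetric]) (simp_all add: X_def power_mult_distrib mult_ac ennreal_leI)
      qed
      finally show ?thesis .
    qed
    have hh: "ennreal (\<kappa> * L\<^sup>2) * r s * ?g (x - y) \<le> (\<integral>\<^sup>+h. \<integral>\<^sup>+\<omega>. ennreal ((X s (y, h) \<omega>)\<^sup>2) \<partial>M \<partial>\<mu>)" for y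
    proof -
      have "ennreal (\<kappa> * L\<^sup>2) * r s * ?g (x - y) = ennreal (L\<^sup>2) * r s * ?g (x - y) * ennreal \<kappa>"
        using \<open>0 < \<kappa>\<close> by (simp add: ennreal_mult' mult_ac)
      also have "\<dots> \<le> ennreal (L\<^sup>2) * r s * ?g (x - y) * (\<integral>\<^sup>+h. ennreal ((J' h)\<^sup>2) \<partial>\<mu>)"
        by (intro mult_left_mono J'_int) simp
      also have "\<dots> = (\<integral>\<^sup>+h. ennreal (L\<^sup>2) * r s * ?g (x - y) * ennreal ((J' h)\<^sup>2) \<partial>\<mu>)"
        by (rule nn_integral_cmult[symmetric]) measurable
      also have "\<dots> \<le> (\<integral>\<^sup>+h. \<integral>\<^sup>+\<omega>. ennreal ((X s (y, h) \<omega>)\<^sup>2) \<partial>M \<partial>\<mu>)"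
        by (intro nn_integral_mono om)
      finally show ?thesis .
    qed
    have "ennreal (\<kappa> * L\<^sup>2) * (energy G (t - s) * (indicator {0<..} s * r s)) =
        ennreal (\<kappa> * L\<^sup>2) * r s * (\<integral>\<^sup>+y. ?g y \<partial>lborel)"
      using s by (simp add: energy_def mult_ac)
    also have "(\<integral>\<^sup>+y. ?g y \<partial>lborel) = (\<integral>\<^sup>+y. ?g (x - y) \<partial>lborel)"
      by (rule nn_integral_lborel_reflect[symmetric]) measurable
    also have "ennreal (\<kappa> * L\<^sup>2) * r s * \<dots> = (\<integral>\<^sup>+y. ennreal (\<kappa> * L\<^sup>2) * r s * ?g (x - y) \<partial>lborel)"
      by (rule nn_integral_cmult[symmetric]) measurable
    also have "\<dots> \<le> (\<integral>\<^sup>+y. \<integral>\<^sup>+h. \<integral>\<^sup>+\<omega>. ennreal ((X s (y, h) \<omega>)\<^sup>2) \<partial>M \<partial>\<mu> \<partial>lborel)"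
      by (intro nn_integral_mono hh)
    finally show ?thesis using s by simp
  qed
  have "ennreal (\<kappa> * L\<^sup>2) * (\<integral>\<^sup>+s. energy G (t - s) * (indicator {0<..} s * r s) \<partial>lborel) =
      (\<integral>\<^sup>+s. ennreal (\<kappa> * L\<^sup>2) * (energy G (t - s) * (indicator {0<..} s * r s)) \<partial>lborel)"
    by (rule nn_integral_cmult[symmetric]) measurable
  also have "\<dots> \<le> integrand_sqnorm M \<mu> X"
    unfolding integrand_sqnorm_def by (intro nn_integral_mono inner)
  also have "\<dots> \<le> (\<integral>\<^sup>+\<omega>. ennreal ((I \<omega>)\<^sup>2) \<partial>M)" by (rule mom(3))
  finally show ?thesis
    unfolding second using m u0(4) by (intro add_mono ennreal_leI power_mono)
qed

end

text \<open>Up to \<open>T\<close> the discounted function is at most \<open>K\<close>, contributing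
  K T; beyond \<open>T\<close> it decays at rate l - l' > 0.\<close>

lemma nn_integral_exp_bounded_finite:
  fixes f :: "real \<Rightarrow> ennreal"
  assumes "l' < l" "0 < T" "K < \<infinity>"
    and small: "\<And>t. 0 < t \<Longrightarrow> t \<le> T \<Longrightarrow> f t \<le> K"
    and large: "\<And>t. T \<le> t \<Longrightarrow> f t \<le> ennreal (exp (l' * t))" and "0 \<le> l"
  shows "(\<integral>\<^sup>+t\<in>{0<..}. ennreal (exp (- (l * t))) * f t \<partial>lborel) < \<infinity>"
proof -
  have "(\<integral>\<^sup>+t\<in>{0<..}. ennreal (exp (- (l * t))) * f t \<partial>lborel) \<le>
      (\<integral>\<^sup>+t. K * indicator {0..T} t + ennreal (exp (- ((l - l') * t))) * indicator {0<..} t \<partial>lborel)"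
  proof (rule nn_integral_mono)
    fix t :: real
    consider "t \<le> 0" | "0 < t" "t \<le> T" | "T < t" "0 < t" using \<open>0 < T\<close> by linarith
    then show "ennreal (exp (- (l * t))) * f t * indicator {0<..} t \<le>
        K * indicator {0..T} t + ennreal (exp (- ((l - l') * t))) * indicator {0<..} t"
    proof cases
      case 2
      have "ennreal (exp (- (l * t))) * f t \<le> 1 * K"
        using 2 \<open>0 \<le> l\<close> by (intro mult_mono small) auto
      then show ?thesis using 2 by (auto intro: add_increasing2)
    next
      case 3
      have "ennreal (exp (- (l * t))) * f t \<le> ennreal (exp (- (l * t))) * ennreal (exp (l' * t))"
        using 3 by (intro mult_left_mono large) auto
      also have "\<dots> = ennreal (exp (- ((l - l') * t)))"
        by (simp add: algebra_simps flip: ennreal_mult' exp_add)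
      finally show ?thesis using 3 by simp
    qed simp
  qed
  also have "\<dots> = K * ennreal T + ennreal (1 / (l - l'))"
    using assms nn_integral_exp_neg[of "l - l'"] by (simp add: nn_integral_add nn_integral_cmult_indicator)
  also have "\<dots> < \<infinity>" using \<open>K < \<infinity>\<close> by (simp add: ennreal_mult_less_top)
  finally show ?thesis .
qed

theorem theorem2p3:
  fixes M :: "'w measure"
    and \<mu> :: "'a::euclidean_space measure"
    and N :: "'w \<Rightarrow> (real \<times> 'a \<times> 'a) measure"
    and G :: "real \<Rightarrow> 'a \<Rightarrow> real"
    and \<sigma> :: "real \<Rightarrow> 'a \<Rightarrow> real"
    and u0 :: "'a \<Rightarrow> real"
    and u :: "real \<Rightarrow> 'a \<Rightarrow> 'w \<Rightarrow> real"
    and J J' :: "'a \<Rightarrow> real"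
    and \<alpha> \<beta> \<nu> Lip K L \<kappa> :: real
  assumes prob: "prob_space M"
    and levy: "levy_measure \<mu>"
    and prm: "poisson_random_measure M (noise_intensity \<mu>) N"
    and sigma_meas: "(\<lambda>(x, h). \<sigma> x h) \<in> borel_measurable (borel \<Otimes>\<^sub>M borel)"
    and params: "\<beta> = 1" "0 < \<alpha>" "\<alpha> \<le> 2" "0 < \<nu>"
    and dim: "real DIM('a) < min 2 (1 / \<beta>) * \<alpha>"
    and kernel: "stable_transition_density \<nu> \<alpha> G"
    and u0: "u0 \<in> borel_measurable borel" "bounded (range u0)" "(INF x. u0 x) > 0"
    and a_J: "J \<in> borel_measurable borel" "\<And>h. 0 \<le> J h"
    and a_const: "0 < Lip" "0 < K"
    and a_zero: "\<And>h. \<sigma> 0 h = 0"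
    and a_lip: "\<And>x y h. \<bar>\<sigma> x h - \<sigma> y h\<bar> \<le> J h * Lip * \<bar>x - y\<bar>"
    and a_int: "(\<integral>\<^sup>+h. ennreal ((J h)\<^sup>2) \<partial>\<mu>) \<le> ennreal K"
    and b_J: "J' \<in> borel_measurable borel" "\<And>h. 0 < J' h"
    and b_const: "0 < L" "0 < \<kappa>"
    and b_lower: "\<And>x h. \<bar>\<sigma> x h\<bar> \<ge> L * J' h * \<bar>x\<bar>"
    and b_int: "(\<integral>\<^sup>+h. ennreal ((J' h)\<^sup>2) \<partial>\<mu>) \<ge> ennreal \<kappa>"
    and sol: "random_field_solution M \<mu> N G \<sigma> u0 u"
  shows "(\<forall>x. upper_second_moment_exponent M u x
               \<ge> Upsilon_inv TYPE('a) \<nu> \<alpha> (1 / (\<kappa> * L\<^sup>2))) \<and>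
         Upsilon_inv TYPE('a) \<nu> \<alpha> (1 / (\<kappa> * L\<^sup>2)) > 0"
proof -
  interpret prob_space M by (rule prob)
  have dim1: "DIM('a) = 1"
  proof -
    have "min 2 (1 / \<beta>) * \<alpha> \<le> 2" using params by simp
    with dim have "real DIM('a) < 2" by linarith
    then show ?thesis using DIM_positive[where 'a = 'a] by linarith
  qed
  have \<alpha>1: "1 < \<alpha>" using dim dim1 params by simp
  have sets_\<mu>[measurable_cong]: "sets \<mu> = sets borel" using levy by (simp add: levy_measure_def)
  (* levy_measure allows infinite mass at the origin, so sigma-finiteness of mu has to come from
     the integrability of J, which dominates a multiple of J'. *)
  have J_pos: "0 < J h" for h
  proof -
    have "L * J' h \<le> \<bar>\<sigma> 1 h\<bar>" using b_lower[of h 1] by simp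
    also have "\<dots> \<le> J h * Lip" using a_lip[of 1 h 0] a_zero[of h] by simp
    finally have "0 < J h * Lip" using b_const b_J(2)[of h] by (meson less_le_trans mult_pos_pos)
    then show ?thesis using a_const(1) by (simp add: zero_less_mult_iff)
  qed
  have "sigma_finite_measure \<mu>"
  proof (rule sigma_finite_positive_integrable)
    show "(\<lambda>h. ennreal ((J h)\<^sup>2)) \<in> borel_measurable \<mu>"
      using a_J(1) by measurable
    show "(\<integral>\<^sup>+h. ennreal ((J h)\<^sup>2) \<partial>\<mu>) < \<infinity>"
      using a_int by (rule le_less_trans) simp
    show "0 < ennreal ((J h)\<^sup>2)" for h using J_pos[of h] by simp
  qed
  then interpret levy_noise M \<mu> N
    by (intro levy_noise.intro levy_noise_axioms.intro prob prm sets_\<mu>)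
  have mild: "mild_solution M \<mu> N G \<sigma> u0 u"
    and sup: "\<And>T. 0 < T \<Longrightarrow> (SUP t\<in>{0..T}. SUP x. \<integral>\<^sup>+\<omega>. ennreal (\<bar>u t x \<omega>\<bar>\<^sup>2) \<partial>M) < \<infinity>"
    using sol by (auto simp: random_field_solution_def)
  have u_meas: "u t x \<in> borel_measurable M" if "0 < t" for t x
    using mild that unfolding mild_solution_def
    by (intro predictable_field_section_measurable[OF _ noise_filtration_subset]) auto
  define f where "f = (\<lambda>t x. \<integral>\<^sup>+\<omega>. ennreal ((u t x \<omega>)\<^sup>2) \<partial>M)"
  have f_le: "f t x \<le> (SUP t\<in>{0..T}. SUP x. \<integral>\<^sup>+\<omega>. ennreal (\<bar>u t x \<omega>\<bar>\<^sup>2) \<partial>M)"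
    if "0 < t" "t \<le> T" for t x T
    unfolding f_def using that by (intro SUP_upper2[of t] SUP_upper2[of x]) auto
  have f_fin: "f t x < \<infinity>" if "0 < t" for t x
    using f_le[OF that order_refl] sup[OF that] by (rule le_less_trans)
  \<comment> \<open>Finiteness guarantees that the Bochner expectation in the growth exponent is the
    true second moment and not the default value 0.\<close>
  have f_expectation: "f t x = ennreal (LINT \<omega>|M. \<bar>u t x \<omega>\<bar>\<^sup>2)" if "0 < t" for t x
    using f_fin[OF that, of x] u_meas[OF that, of x] unfolding f_def
    by (subst integral_eq_nn_integral) (auto simp: less_top)
  define c where "c = (INF x. u0 x)"
  \<comment> \<open>The infimum of reals is a genuine lower bound because the range of
    \<open>u0\<close> is bounded below.\<close>
  have c: "0 < c" "c \<le> u0 y" for y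
    using u0(2,3) unfolding c_def
    by (auto intro!: cINF_lower bounded_imp_bdd_below)
  define k where "k = \<kappa> * L\<^sup>2"
  have k: "0 < k" using b_const by (simp add: k_def)
  note e_meas = energy_measurable[OF kernel]
  let ?r = "renewal (energy G) (ennreal k) (ennreal (c\<^sup>2))"
  have moment_ge: "ennreal (c\<^sup>2) + ennreal k *
      (\<integral>\<^sup>+s. energy G (t - s) * (indicator {0<..} s * r s) \<partial>lborel) \<le> f t x"
    if "\<And>s y. 0 < s \<Longrightarrow> r s \<le> f s y" "r \<in> borel_measurable borel" "0 < t" for r t x
    unfolding f_def k_def
    by (rule mild_solution_second_moment_ge[OF mild kernel u0(1,2) c(2) less_imp_le[OF c(1)]
      b_J b_lower b_const b_int that[unfolded f_def]])
  \<comment> \<open>Each iterate is the measurable minorant that yields the next one; the zero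
    function starts the induction.\<close>
  have lower: "?r n t \<le> f t x" if "0 < t" for n t x
    using that
  proof (induction n arbitrary: t x)
    case 0
    then show ?case using moment_ge[of "\<lambda>_. 0" t x] by simp
  next
    case (Suc n)
    then show ?case using moment_ge[of "?r n" t x] renewal_measurable[OF e_meas] by simp
  qed
  have growth: "ereal l \<le> upper_second_moment_exponent M u x"
    if l: "0 < l" "ennreal (1 / k) < Upsilon TYPE('a) \<nu> \<alpha> l" for l x
  proof (rule ccontr)
    assume "\<not> ereal l \<le> upper_second_moment_exponent M u x"
    then have "upper_second_moment_exponent M u x < ereal l" by simp
    \<comment> \<open>A real rate strictly between the exponent and \<open>l\<close> leaves an
      exponential margin, which makes the Laplace transform of the second moment at \<open>l\<close>
      finite.\<close>
    then obtain l' where l': "upper_second_moment_exponent M u x < ereal l'" "l' < l"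
      using ereal_dense2 by (metis less_ereal.simps(1))
    have "\<forall>\<^sub>F t in at_top. ereal (1 / t * ln (LINT \<omega>|M. \<bar>u t x \<omega>\<bar>\<^sup>2)) < ereal l'"
      using l'(1) unfolding upper_second_moment_exponent_def by (rule Limsup_lessD)
    then obtain T0 where T0: "\<And>t. T0 \<le> t \<Longrightarrow> 1 / t * ln (LINT \<omega>|M. \<bar>u t x \<omega>\<bar>\<^sup>2) < l'"
      by (auto simp: eventually_at_top_linorder)
    define T where "T = max T0 1"
    have large: "f t x \<le> ennreal (exp (l' * t))" if "T \<le> t" for t
    proof -
      have t: "0 < t" "T0 \<le> t" using that by (auto simp: T_def)
      \<comment> \<open>Positivity of the second moment is required to undo the logarithm; it is the
        iterate with index 0.\<close>
      have "0 < ennreal (c\<^sup>2)" using c(1) by simp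
      also have "\<dots> \<le> f t x" using lower[OF t(1), of 0 x] by simp
      finally have pos: "0 < (LINT \<omega>|M. \<bar>u t x \<omega>\<bar>\<^sup>2)" using f_expectation[OF t(1), of x] by simp
      have "ln (LINT \<omega>|M. \<bar>u t x \<omega>\<bar>\<^sup>2) < l' * t"
        using T0[OF t(2)] t(1) by (simp add: field_simps)
      then have "(LINT \<omega>|M. \<bar>u t x \<omega>\<bar>\<^sup>2) < exp (l' * t)"
        using pos by (metis exp_less_mono exp_ln)
      then show ?thesis unfolding f_expectation[OF t(1)] by (intro ennreal_leI) simp
    qed
    have "(\<integral>\<^sup>+t\<in>{0<..}. ennreal (exp (- (l * t))) * f t x \<partial>lborel) < \<infinity>"
    \<comment> \<open>The bound on (0, T] is the finite supremum in the definition of a random field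
      solution.\<close>
    proof (rule nn_integral_exp_bounded_finite[OF l'(2) _ sup f_le large])
      show "0 < T" "0 < T" "0 \<le> l" using l(1) by (auto simp: T_def)
    qed
    then obtain C where C: "(\<integral>\<^sup>+t\<in>{0<..}. ennreal (exp (- (l * t))) * f t x \<partial>lborel) = ennreal C" "0 \<le> C"
      by (cases "\<integral>\<^sup>+t\<in>{0<..}. ennreal (exp (- (l * t))) * f t x \<partial>lborel") auto
    \<comment> \<open>This is where 1/(\<kappa> L^2) becomes the threshold: above it, one round of
      the renewal equation does not shrink the Laplace transform at \<open>l\<close>.\<close>
    have supercritical: "1 \<le> ennreal k * (\<integral>\<^sup>+t. ennreal (exp (- (l * t))) * energy G t \<partial>lborel)"
    proof -
      have "1 = ennreal k * ennreal (1 / k)" using k by (simp flip: ennreal_mult')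
      also have "\<dots> \<le> ennreal k * Upsilon TYPE('a) \<nu> \<alpha> l"
        using l(2) by (intro mult_left_mono) auto
      also have "Upsilon TYPE('a) \<nu> \<alpha> l \<le>
          (\<integral>\<^sup>+t\<in>{0<..}. ennreal (exp (- (l * t))) * (\<integral>\<^sup>+y. ennreal ((G t y)\<^sup>2) \<partial>lborel) \<partial>lborel)"
        by (rule Upsilon_le_laplace[OF dim1 kernel params(4) l(1)])
      also have "\<dots> = (\<integral>\<^sup>+t. ennreal (exp (- (l * t))) * energy G t \<partial>lborel)"
        by (intro nn_integral_cong) (simp add: energy_def mult_ac)
      finally show ?thesis by (simp add: mult_left_mono)
    qed
    have bound: "of_nat (Suc n) * (ennreal (c\<^sup>2) * ennreal (1 / l)) \<le> ennreal C" for n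
    proof -
      have "of_nat (Suc n) * (ennreal (c\<^sup>2) * ennreal (1 / l)) \<le>
          (\<integral>\<^sup>+t\<in>{0<..}. ennreal (exp (- (l * t))) * ?r n t \<partial>lborel)"
        by (rule renewal_laplace_ge[OF e_meas _ l(1) supercritical]) (simp add: energy_def)
      also have "\<dots> \<le> (\<integral>\<^sup>+t\<in>{0<..}. ennreal (exp (- (l * t))) * f t x \<partial>lborel)"
        using lower by (intro nn_integral_mono) (auto split: split_indicator intro: mult_left_mono)
      finally show ?thesis unfolding C(1) .
    qed
    have "real (Suc n) * (c\<^sup>2 / l) \<le> C" for n
    proof -
      have "ennreal (real (Suc n) * (c\<^sup>2 / l)) \<le> ennreal C"
        using bound[of n] l(1) unfolding ennreal_of_nat_eq_real_of_nat
        by (simp add: ennreal_mult'[symmetric] del: of_nat_Suc)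
      then show ?thesis using C(2) by (simp add: ennreal_le_iff)
    qed
    \<comment> \<open>The lower bounds grow linearly in \<open>n\<close> with positive slope c^2 / l
      and must overtake the finite transform \<open>C\<close>.\<close>
    moreover obtain n where "C < real n * (c\<^sup>2 / l)"
      using reals_Archimedean3[of "c\<^sup>2 / l"] c(1) l(1) by auto
    moreover have "real n * (c\<^sup>2 / l) \<le> real (Suc n) * (c\<^sup>2 / l)"
      using l(1) by (intro mult_right_mono) auto
    ultimately show False by (meson not_le order_trans)
  qed
  obtain l where l: "0 < l" "ennreal (1 / k) < Upsilon TYPE('a) \<nu> \<alpha> l"
    using Upsilon_gt[OF dim1 \<alpha>1 params(4), of "1 / k"] k by auto
  have "ereal l \<le> Upsilon_inv TYPE('a) \<nu> \<alpha> (1 / k)"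
    unfolding Upsilon_inv_def using l by (intro Sup_upper) auto
  then have "0 < Upsilon_inv TYPE('a) \<nu> \<alpha> (1 / k)"
    using l(1) by (metis ereal_less(2) less_le_trans)
  \<comment> \<open>Every \<open>l\<close> in the set whose supremum is \<open>Upsilon_inv\<close>
    is a lower bound of the exponent by \<open>growth\<close>, hence so is the supremum.\<close>
  moreover have "Upsilon_inv TYPE('a) \<nu> \<alpha> (1 / k) \<le> upper_second_moment_exponent M u x" for x
    unfolding Upsilon_inv_def by (rule Sup_least) (auto intro: growth)
  ultimately show ?thesis unfolding k_def by simp
qed

end
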